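(* There exists a self-affine sponge $F\subset\mathbb{R}^3$, the attractor of an iterated function system all of whose maps have diagonal linear parts and which satisfies the cuboidal open set condition (COSC), such that $$\overline{\dim}_{\mathrm B}F<\underline{s_0}=\overline{s_0}.$$
   Context: **Sponges.** Let $\mathcal I$ be a finite set with at least two elements and let $\{S_i\}_{i\in\mathcal I}$ be affine contractions of $\mathbb{R}^3$ such that the linear part of each $S_i$ is a generalised permutation matrix (exactly one nonzero entry in each row and in each column) and $S_i([0,1]^3)\subset[0,1]^3$. The attractor $F$ is the unique non-empty compact set with $F=\bigcup_{i\in\mathcal I}S_i(F)$, and is called a self-affine sponge. **Words.** $\mathcal I^*=\bigcup_{n\ge1}\mathcal I^n$; for $\mathbf i=i_1\cdots i_n$, $S_{\mathbf i}=S_{i_1}\circ\cdots\circ S_{i_n}$, and $\alpha_1(\mathbf i)\ge\alpha_2(\mathbf i)\ge\alpha_3(\mathbf i)$ are the singular values of the linear part of $S_{\mathbf i}$. **Dimensions.** $N_\delta(E)$ is the minimum number of boxes (cubes) of sidelength $\delta$ needed to cover $E$; $\overline{\dim}_{\mathrm B}E$ and $\underline{\dim}_{\mathrm B}E$ are the limsup and liminf of $\log N_\delta(E)/(-\log\delta)$ as $\delta\to0$, and $\dim_{\mathrm B}E$ is the common value if they agree. The quasi-Assouad dimension is $\dim_{\mathrm{qA}}E=\lim_{\varepsilon\to0}h_E(\varepsilon)$, where $h_E(\varepsilon)$ is the infimum of those $\alpha$ for which there is $C>0$ with $N_r(B(x,R)\cap E)\le C(R/r)^\alpha$ for all $0<r\le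 R^{1+\varepsilon}<1$ and $x\in E$. **Projections.** For $\mathbf i\in\mathcal I^*$ let $\pi^1_{\mathbf i}$ be the projection onto the coordinate axis parallel to the longest edges of the cuboid $S_{\mathbf i}([0,1]^3)$, and $\pi^2_{\mathbf i}$ the projection onto the coordinate plane perpendicular to its shortest edges (if these are not unique, choose one possibility arbitrarily). Put $\underline{p_1}(\mathbf i)=\dim_{\mathrm B}\pi^1_{\mathbf i}F$ (this box dimension exists), $\overline{p_1}(\mathbf i)=\dim_{\mathrm{qA}}\pi^1_{\mathbf i}F$, $\overline{p_2}(\mathbf i)=\overline{\dim}_{\mathrm B}\pi^2_{\mathbf i}F$, $\underline{p_2}(\mathbf i)=\underline{\dim}_{\mathrm B}\pi^2_{\mathbf i}F$. **Pressure.** For $s\ge0$, $$\overline\psi^s(\mathbf i)=\alpha_1(\mathbf i)^{\overline{p_1}(\mathbf i)}\alpha_2(\mathbf i)^{\overline{p_2}(\mathbf i)-\overline{p_1}(\mathbf i)}\alpha_3(\mathbf i)^{s-\overline{p_2}(\mathbf i)},\qquad \underline\psi^s(\mathbf i)=\alpha_1(\mathbf i)^{\underline{p_1}(\mathbf i)}\alpha_2(\mathbf i)^{\underline{p_2}(\mathbf i)-\underline{p_1}(\mathbf i)}\alpha_3(\mathbf i)^{s-\underline{p_2}(\mathbf i)}.$$ The limits $\overline P(s)=\lim_k\big(\sum_{\mathbf i\in\mathcal I^k}\overline\psi^s(\mathbf i)\big)^{1/k}$ and $\underline P(s)=\lim_k\big(\sum_{\mathbf i\in\mathcal I^k}\underline\psi^s(\mathbf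 i)\big)^{1/k}$ exist and are continuous and strictly decreasing in $s$; $\overline{s_0}>0$ and $\underline{s_0}>0$ are the unique values with $\overline P(\overline{s_0})=1$ and $\underline P(\underline{s_0})=1$. **COSC.** $\{S_i\}_{i\in\mathcal I}$ satisfies the COSC if there is a non-empty open cuboid $C=(a,b)\times(c,d)\times(e,f)\subset\mathbb{R}^3$ such that the sets $S_i(C)$, $i\in\mathcal I$, are pairwise disjoint subsets of $C$. *)

theory Defs
  imports "HOL-Analysis.Analysis"
begin

(* Intended for bounded E only: otherwise no finite cover exists and LEAST is unspecified. *)
definition covering_number :: "real \<Rightarrow> (real^'n) set \<Rightarrow> nat" where
  "covering_number \<delta> E =
     (LEAST n. \<exists>T. finite T \<and> card T = n \<and> E \<subseteq> (\<Union>a\<in>T. cbox a (a + vec \<delta>)))"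

definition upper_box_dim :: "(real^'n) set \<Rightarrow> ereal" where
  "upper_box_dim E =
     Limsup (at_right 0) (\<lambda>\<delta>. ereal (ln (real (covering_number \<delta> E)) / (- ln \<delta>)))"

definition lower_box_dim :: "(real^'n) set \<Rightarrow> ereal" where
  "lower_box_dim E =
     Liminf (at_right 0) (\<lambda>\<delta>. ereal (ln (real (covering_number \<delta> E)) / (- ln \<delta>)))"

definition box_dim :: "(real^'n) set \<Rightarrow> ereal" where
  "box_dim E = (THE d. lower_box_dim E = d \<and> upper_box_dim E = d)"

definition assouad_gap_dim :: "(real^'n) set \<Rightarrow> real \<Rightarrow> ereal" where
  "assouad_gap_dim E \<epsilon> = Inf (ereal ` {\<alpha>. \<exists>C>0. \<forall>r R. \<forall>x\<in>E.
     0 < r \<and> 0 < R \<and> r \<le> R powr (1 + \<epsilon>) \<and> R powr (1 + \<epsilon>) < 1 \<longrightarrow>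
       real (covering_number r (ball x R \<inter> E)) \<le> C * (R / r) powr \<alpha>})"

definition quasi_assouad_dim :: "(real^'n) set \<Rightarrow> ereal" where
  "quasi_assouad_dim E = Lim (at_right 0) (assouad_gap_dim E)"

definition affine_map :: "(real^'n \<Rightarrow> real^'n) \<Rightarrow> bool" where
  "affine_map f \<longleftrightarrow> linear (\<lambda>x. f x - f 0)"

definition linear_part :: "(real^'n \<Rightarrow> real^'n) \<Rightarrow> real^'n^'n" where
  "linear_part f = matrix (\<lambda>x. f x - f 0)"

definition generalised_permutation_matrix :: "real^'n^'n \<Rightarrow> bool" where
  "generalised_permutation_matrix A \<longleftrightarrow>
     (\<forall>i. \<exists>!j. A $ i $ j \<noteq> 0) \<and> (\<forall>j. \<exists>!i. A $ i $ j \<noteq> 0)"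

definition diagonal_matrix :: "real^'n^'n \<Rightarrow> bool" where
  "diagonal_matrix A \<longleftrightarrow> (\<forall>i j. i \<noteq> j \<longrightarrow> A $ i $ j = 0)"

(* The square roots of the eigenvalues of transpose A ** A, with multiplicity (the roots of its
   characteristic polynomial), listed in decreasing order. *)
definition singular_values :: "real^'n^'n \<Rightarrow> real list" where
  "singular_values A = (THE \<sigma>. length \<sigma> = CARD('n) \<and> sorted_wrt (\<ge>) \<sigma> \<and> (\<forall>t\<in>set \<sigma>. 0 \<le> t) \<and>
     (\<forall>x. det (mat x - transpose A ** A) = (\<Prod>t\<leftarrow>\<sigma>. x - t\<^sup>2)))"

definition sponge_ifs :: "'i set \<Rightarrow> ('i \<Rightarrow> real^3 \<Rightarrow> real^3) \<Rightarrow> bool" where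
  "sponge_ifs I S \<longleftrightarrow> finite I \<and> card I \<ge> 2 \<and>
     (\<forall>i\<in>I. affine_map (S i) \<and> (\<exists>c<1. c-lipschitz_on UNIV (S i)) \<and>
        generalised_permutation_matrix (linear_part (S i)) \<and>
        S i ` cbox 0 (vec 1) \<subseteq> cbox 0 (vec 1))"

(* By Hutchinson's theorem there is exactly one such F for a finite family of contractions. *)
definition is_attractor ::
    "'i set \<Rightarrow> ('i \<Rightarrow> real^3 \<Rightarrow> real^3) \<Rightarrow> (real^3) set \<Rightarrow> bool" where
  "is_attractor I S F \<longleftrightarrow> F \<noteq> {} \<and> compact F \<and> F = (\<Union>i\<in>I. S i ` F)"

definition cosc :: "'i set \<Rightarrow> ('i \<Rightarrow> real^3 \<Rightarrow> real^3) \<Rightarrow> bool" where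
  "cosc I S \<longleftrightarrow> (\<exists>l u. box l u \<noteq> {} \<and> (\<forall>i\<in>I. S i ` box l u \<subseteq> box l u) \<and>
     disjoint_family_on (\<lambda>i. S i ` box l u) I)"

definition words :: "'i set \<Rightarrow> nat \<Rightarrow> 'i list set" where
  "words I k = {w. set w \<subseteq> I \<and> length w = k}"

fun word_map :: "('i \<Rightarrow> 'a \<Rightarrow> 'a) \<Rightarrow> 'i list \<Rightarrow> 'a \<Rightarrow> 'a" where
  "word_map S [] = id"
| "word_map S (i # w) = S i \<circ> word_map S w"

definition word_sv :: "('i \<Rightarrow> real^3 \<Rightarrow> real^3) \<Rightarrow> nat \<Rightarrow> 'i list \<Rightarrow> real" where
  "word_sv S k w = singular_values (linear_part (word_map S w)) ! (k - 1)"

(* The image of the unit cube is a cuboid with edges parallel to the axes; its edges parallel to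
   the j-th axis have this length. *)
definition edge_length :: "('i \<Rightarrow> real^3 \<Rightarrow> real^3) \<Rightarrow> 'i list \<Rightarrow> 3 \<Rightarrow> real" where
  "edge_length S w j = diameter ((\<lambda>x. x $ j) ` word_map S w ` cbox 0 (vec 1))"

(* Projections stay inside the ambient space; covering numbers of subsets of a coordinate axis or
   plane are the same whether counted by cubes there or by cubes in the ambient space. *)
definition axis_proj :: "3 \<Rightarrow> real^3 \<Rightarrow> real^3" where
  "axis_proj j x = (\<chi> k. if k = j then x $ k else 0)"

definition plane_proj :: "3 \<Rightarrow> real^3 \<Rightarrow> real^3" where
  "plane_proj j x = (\<chi> k. if k = j then 0 else x $ k)"

(* A choice, for each word w, of the direction a w of a longest edge and the direction b w of a
   shortest edge; the associated projections are axis_proj (a w) and plane_proj (b w). *)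
definition direction_choice ::
    "'i set \<Rightarrow> ('i \<Rightarrow> real^3 \<Rightarrow> real^3) \<Rightarrow> ('i list \<Rightarrow> 3) \<Rightarrow> ('i list \<Rightarrow> 3) \<Rightarrow> bool" where
  "direction_choice I S a b \<longleftrightarrow> (\<forall>k\<ge>1. \<forall>w\<in>words I k. \<forall>j.
     edge_length S w j \<le> edge_length S w (a w) \<and> edge_length S w (b w) \<le> edge_length S w j)"

definition psi ::
    "('i \<Rightarrow> real^3 \<Rightarrow> real^3) \<Rightarrow> ('i list \<Rightarrow> real) \<Rightarrow> ('i list \<Rightarrow> real) \<Rightarrow> real \<Rightarrow> 'i list \<Rightarrow> real" where
  "psi S p1 p2 s w =
     word_sv S 1 w powr p1 w * word_sv S 2 w powr (p2 w - p1 w) * word_sv S 3 w powr (s - p2 w)"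

definition upper_psi where
  "upper_psi S F a b = psi S
     (\<lambda>w. real_of_ereal (quasi_assouad_dim (axis_proj (a w) ` F)))
     (\<lambda>w. real_of_ereal (upper_box_dim (plane_proj (b w) ` F)))"

definition lower_psi where
  "lower_psi S F a b = psi S
     (\<lambda>w. real_of_ereal (box_dim (axis_proj (a w) ` F)))
     (\<lambda>w. real_of_ereal (lower_box_dim (plane_proj (b w) ` F)))"

definition pressure :: "'i set \<Rightarrow> (real \<Rightarrow> 'i list \<Rightarrow> real) \<Rightarrow> real \<Rightarrow> real" where
  "pressure I \<psi> s = lim (\<lambda>k. root k (\<Sum>w\<in>words I k. \<psi> s w))"

definition upper_s0 where
  "upper_s0 I S F a b = (THE s. 0 \<le> s \<and> pressure I (upper_psi S F a b) s = 1)"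

definition lower_s0 where
  "lower_s0 I S F a b = (THE s. 0 \<le> s \<and> pressure I (lower_psi S F a b) s = 1)"

end

theory Submission imports Defs begin

text \<open>
  The affine dimension formula treats the image of the sponge under a word as if its planar
  projection were stretched in the direction that is worst for covering. The example lets two
  planar directions compete: the box dimension of the planar projection is governed by tiles that
  are tall in the second coordinate, while the words that dominate the sums of the three-dimensional
  system are long in the first coordinate. The formula charges these words the full planar
  dimension, although a planar set stretched along the first coordinate needs far fewer boxes.

  All tiles have width \<open>1/4\<close> and thickness \<open>1/64\<close>, and each of four columns of width \<open>1/4\<close> carries
  one planar rectangle: two columns have rectangles of height \<open>1/16\<close>, two have rectangles of height
  \<open>15/16\<close>. Every flat rectangle is repeated in 64 layers in the third direction, every tall
  one occurs only once. The following points carry the proof.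

  \<^item> The third edge is always the strictly shortest, so the plane in the formula is always the plane of
  the first two coordinates, and the axis is one of these two. Both axis projections of the
  attractor are unit segments, of box and quasi-Assouad dimension 1 (\<open>attractor_coordinate_full\<close>).

  \<^item> The planar projection has box dimension \<open>3/2\<close>. At scale \<open>4\<^sup>-\<^sup>k\<close> it consists of one piece per column
  word, of full height, and the heights of these pieces sum to \<open>2\<^sup>k\<close>; this gives
  about \<open>2\<^sup>k 4\<^sup>k = (4\<^sup>k)\<^sup>3\<^sup>/\<^sup>2\<close> cubes (\<open>upper_box_dim_plane\<close>, \<open>lower_box_dim_plane\<close>).

  \<^item> Hence both versions of \<open>\<psi>\<close> agree, and at a word of length \<open>k\<close> and height \<open>d\<close> they are
  \<open>max (4\<^sup>-\<^sup>k \<surd>d) (2\<^sup>-\<^sup>k d)\<close> times \<open>64\<^sup>-\<^sup>k\<^sup>(\<^sup>s\<^sup>-\<^sup>3\<^sup>/\<^sup>2\<^sup>)\<close>. Up to a factor 2 the sum of a maximum of two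
  multiplicative weights is the larger of the two sums. The first weight, which belongs to the
  words long in the first direction, wins: its sum over the tiles is \<open>8 + \<surd>15/8\<close>, against \<open>79/16\<close>.
  The pressure is therefore \<open>(8 + \<surd>15/8) 64\<^sup>3\<^sup>/\<^sup>2\<^sup>-\<^sup>s\<close> (\<open>pressure_sponge\<close>). As \<open>64\<^sup>1\<^sup>/\<^sup>2 = 8\<close>, its value at
  \<open>s = 2\<close> exceeds 1, so its zero lies above 2.

  \<^item> The upper box dimension is at most 2 (\<open>upper_box_dim_sponge\<close>). At scale \<open>64\<^sup>-\<^sup>k = 4\<^sup>-\<^sup>3\<^sup>k\<close> the image
  under a word of length \<open>k\<close> is a thin slab, and its planar projection is cut by column words of
  length \<open>2k\<close> into pieces of exactly this width. Stacking cubes along the heights takes at most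
  \<open>2528\<^sup>k + 2080\<^sup>k\<close> cubes, one per piece being due to rounding, and both bases are below \<open>4096 = 64\<^sup>2\<close>.
\<close>

section \<open>Covering numbers and box dimension\<close>

lemma covering_number_le:
  fixes E :: "(real^'n) set"
  assumes "finite T" "E \<subseteq> (\<Union>a\<in>T. cbox a (a + vec \<delta>))"
  shows "covering_number \<delta> E \<le> card T"
  unfolding covering_number_def using assms by (intro Least_le) blast

lemma bounded_finite_cube_cover:
  fixes E :: "(real^'n) set"
  assumes "bounded E" "\<delta> > 0"
  shows "\<exists>T. finite T \<and> E \<subseteq> (\<Union>a\<in>T. cbox a (a + vec \<delta>))"
proof -
  define B where "B x = box (x - vec (\<delta>/2)) (x + vec (\<delta>/2))" for x :: "real^'n"
  have "compact (closure E)" using assms by simp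
  moreover have "closure E \<subseteq> (\<Union>x\<in>closure E. B x)"
    using assms(2) by (auto simp: B_def mem_box_cart)
  moreover have "open (B x)" for x by (simp add: B_def open_box)
  ultimately obtain D where D: "D \<subseteq> closure E" "finite D" "closure E \<subseteq> (\<Union>x\<in>D. B x)"
    by (metis compactE_image)
  have "B x \<subseteq> cbox (x - vec (\<delta>/2)) ((x - vec (\<delta>/2)) + vec \<delta>)" for x
  proof
    fix y assume "y \<in> B x"
    then have "x $ i - \<delta>/2 < y $ i \<and> y $ i < x $ i + \<delta>/2" for i
      by (simp add: B_def mem_box_cart)
    then have "x $ i - \<delta>/2 \<le> y $ i \<and> y $ i \<le> x $ i - \<delta>/2 + \<delta>" for i
      by (smt (verit) field_sum_of_halves)
    then show "y \<in> cbox (x - vec (\<delta>/2)) ((x - vec (\<delta>/2)) + vec \<delta>)"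
      by (simp add: mem_box_cart)
  qed
  then have "E \<subseteq> (\<Union>a\<in>(\<lambda>x. x - vec (\<delta>/2)) ` D. cbox a (a + vec \<delta>))"
    using D(3) closure_subset[of E] by (simp add: UN_subset_iff) (meson UN_mono order_refl order_trans)
  then show ?thesis using D(2) by blast
qed

lemma optimal_cube_cover:
  fixes E :: "(real^'n) set"
  assumes "bounded E" "\<delta> > 0"
  obtains T where "finite T" "card T = covering_number \<delta> E"
    "E \<subseteq> (\<Union>a\<in>T. cbox a (a + vec \<delta>))"
proof -
  have "\<exists>n T. finite T \<and> card T = n \<and> E \<subseteq> (\<Union>a\<in>T. cbox a (a + vec \<delta>))"
    using bounded_finite_cube_cover[OF assms] by blast
  from LeastI_ex[OF this] show ?thesis
    using that unfolding covering_number_def by blast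
qed

lemma covering_number_mono:
  fixes E E' :: "(real^'n) set"
  assumes "bounded E'" "E \<subseteq> E'" "0 < \<delta>'" "\<delta>' \<le> \<delta>"
  shows "covering_number \<delta> E \<le> covering_number \<delta>' E'"
proof -
  obtain T where T: "finite T" "card T = covering_number \<delta>' E'"
    "E' \<subseteq> (\<Union>a\<in>T. cbox a (a + vec \<delta>'))"
    using optimal_cube_cover[OF assms(1,3)] by blast
  have "cbox a (a + vec \<delta>') \<subseteq> cbox a (a + vec \<delta>)" for a :: "real^'n"
    using assms(4) by (auto simp: mem_box_cart) (meson add_left_mono order_trans)
  then have "(\<Union>a\<in>T. cbox a (a + vec \<delta>')) \<subseteq> (\<Union>a\<in>T. cbox a (a + vec \<delta>))"
    by (intro UN_mono) auto
  then have "E \<subseteq> (\<Union>a\<in>T. cbox a (a + vec \<delta>))" using T(3) assms(2) by (meson order_trans)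
  from covering_number_le[OF T(1) this] T(2) show ?thesis by simp
qed

lemma covering_number_UN_le:
  fixes E :: "'a \<Rightarrow> (real^'n) set"
  assumes "finite A" "\<And>i. i \<in> A \<Longrightarrow> bounded (E i)" "\<delta> > 0"
  shows "covering_number \<delta> (\<Union>i\<in>A. E i) \<le> (\<Sum>i\<in>A. covering_number \<delta> (E i))"
proof -
  have "\<forall>i\<in>A. \<exists>T. finite T \<and> card T = covering_number \<delta> (E i) \<and>
      E i \<subseteq> (\<Union>a\<in>T. cbox a (a + vec \<delta>))"
    using optimal_cube_cover[OF assms(2) assms(3)] by metis
  then obtain T where T: "\<And>i. i \<in> A \<Longrightarrow> finite (T i)"
     "\<And>i. i \<in> A \<Longrightarrow> card (T i) = covering_number \<delta> (E i)"
     "\<And>i. i \<in> A \<Longrightarrow> E i \<subseteq> (\<Union>a\<in>T i. cbox a (a + vec \<delta>))"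
    by metis
  have "covering_number \<delta> (\<Union>i\<in>A. E i) \<le> card (\<Union>i\<in>A. T i)"
  proof (rule covering_number_le)
    show "finite (\<Union>i\<in>A. T i)" using T(1) assms(1) by blast
    show "(\<Union>i\<in>A. E i) \<subseteq> (\<Union>a\<in>(\<Union>i\<in>A. T i). cbox a (a + vec \<delta>))"
      using T(3) by (simp add: UN_UN_flatten) (meson UN_mono order_refl)
  qed
  also have "\<dots> \<le> (\<Sum>i\<in>A. card (T i))" by (rule card_UN_le[OF assms(1)])
  finally show ?thesis using T(2) by simp
qed

text \<open>A chain of cubes stacked in direction \<open>m\<close> suffices for a set that is thin in all other directions.\<close>

lemma covering_number_slab_le:
  fixes E :: "(real^'n) set"
  assumes \<delta>: "\<delta> > 0" and L: "L \<ge> 0"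
    and E: "\<And>x j. x \<in> E \<Longrightarrow> j \<noteq> m \<Longrightarrow> l $ j \<le> x $ j \<and> x $ j \<le> l $ j + \<delta>"
      "\<And>x. x \<in> E \<Longrightarrow> l $ m \<le> x $ m \<and> x $ m \<le> l $ m + L"
  shows "real (covering_number \<delta> E) \<le> L / \<delta> + 1"
proof -
  define n where "n = Suc (nat \<lfloor>L / \<delta>\<rfloor>)"
  define p where "p k = l + axis m (real k * \<delta>)" for k :: nat
  have sub: "E \<subseteq> (\<Union>a\<in>p ` {..<n}. cbox a (a + vec \<delta>))"
  proof
    fix x assume x: "x \<in> E"
    define k where "k = nat \<lfloor>(x $ m - l $ m) / \<delta>\<rfloor>"
    have nn: "(x $ m - l $ m) / \<delta> \<ge> 0" using E(2)[OF x] \<delta> by simp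
    have "\<lfloor>(x $ m - l $ m) / \<delta>\<rfloor> \<le> \<lfloor>L / \<delta>\<rfloor>"
      using E(2)[OF x] \<delta> by (intro floor_mono divide_right_mono) auto
    then have "k < n" unfolding k_def n_def by linarith
    moreover have "real k \<le> (x $ m - l $ m) / \<delta>" "(x $ m - l $ m) / \<delta> \<le> real k + 1"
      using nn unfolding k_def by linarith+
    then have "real k * \<delta> \<le> x $ m - l $ m" "x $ m - l $ m \<le> real k * \<delta> + \<delta>"
      using \<delta> by (simp_all add: field_simps)
    then have "x \<in> cbox (p k) (p k + vec \<delta>)"
      using E(1)[OF x] by (auto simp: mem_box_cart p_def axis_def)
    ultimately show "x \<in> (\<Union>a\<in>p ` {..<n}. cbox a (a + vec \<delta>))" by blast
  qed
  have "covering_number \<delta> E \<le> card (p ` {..<n})"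
    by (rule covering_number_le[OF _ sub]) simp
  also have "\<dots> \<le> n" using card_image_le[of "{..<n}" p] by simp
  finally have "real (covering_number \<delta> E) \<le> real n" by simp
  also have "real n \<le> L / \<delta> + 1"
    using L \<delta> unfolding n_def by (simp add: floor_le_iff)
  finally show ?thesis .
qed

lemma covering_number_cbox_le:
  fixes a s :: "real^'n"
  assumes "\<delta> > 0" "s $ m \<ge> 0" "\<And>j. j \<noteq> m \<Longrightarrow> s $ j \<le> \<delta>"
  shows "real (covering_number \<delta> (cbox a (a + s))) \<le> s $ m / \<delta> + 1"
proof (rule covering_number_slab_le[where m = m and l = a])
  fix x assume "x \<in> cbox a (a + s)"
  then have *: "a $ j \<le> x $ j \<and> x $ j \<le> a $ j + s $ j" for j by (simp add: mem_box_cart)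
  then show "a $ m \<le> x $ m \<and> x $ m \<le> a $ m + s $ m" by blast
  show "a $ j \<le> x $ j \<and> x $ j \<le> a $ j + \<delta>" if "j \<noteq> m" for j
    using * [of j] assms(3)[OF that] by linarith
qed (use assms in auto)

text \<open>Each cube projects to an interval of length \<open>\<delta>\<close>, so Lebesgue measure on the line bounds the number of
cubes from below. This is the only source of lower bounds for covering numbers here.\<close>

lemma interval_length_le_card_cover:
  fixes E :: "(real^'n) set"
  assumes "finite T" "E \<subseteq> (\<Union>a\<in>T. cbox a (a + vec \<delta>))" "\<delta> \<ge> 0"
    and "{l..u} \<subseteq> (\<lambda>x. x $ m) ` E"
  shows "u - l \<le> real (card T) * \<delta>"
proof (cases "l \<le> u")
  case True
  have "{l..u} \<subseteq> (\<Union>a\<in>T. {a $ m..a $ m + \<delta>})"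
    using assms(2,4) by (fastforce simp: mem_box_cart subset_iff image_iff)
  then have "measure lborel {l..u} \<le> measure lborel (\<Union>a\<in>T. {a $ m..a $ m + \<delta>})"
    using assms(1) by (intro measure_mono_fmeasurable fmeasurable.finite_UN) (auto simp: fmeasurable_def emeasure_lborel_Icc_eq)
  also have "\<dots> \<le> (\<Sum>a\<in>T. measure lborel {a $ m..a $ m + \<delta>})"
    by (rule measure_UNION_le) (use assms(1) in auto)
  finally show ?thesis using True assms(3) by simp
next
  case False
  then show ?thesis using assms(3) by (smt (verit) of_nat_0_le_iff mult_nonneg_nonneg)
qed

lemma power_scale:
  fixes b \<delta> :: real
  assumes "b > 1" "0 < \<delta>" "\<delta> < 1"
  obtains k where "b ^ k \<le> 1 / \<delta>" "1 / \<delta> < b ^ Suc k"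
proof -
  obtain n where "1 / \<delta> < b ^ n" using real_arch_pow[OF assms(1)] by blast
  define m where "m = (LEAST n. 1 / \<delta> < b ^ n)"
  have m: "1 / \<delta> < b ^ m" unfolding m_def by (rule LeastI) fact
  have "m \<noteq> 0" using m assms by (auto intro: ccontr)
  then obtain k where k: "m = Suc k" using not0_implies_Suc by blast
  then have "\<not> 1 / \<delta> < b ^ k" using not_less_Least[of k "\<lambda>n. 1 / \<delta> < b ^ n"] by (simp add: m_def)
  then show ?thesis using that[of k] m k by (auto simp: not_less)
qed

lemma tendsto_add_const_over_log:
  "((\<lambda>\<delta>. t + K / (- ln \<delta>)) \<longlongrightarrow> t) (at_right (0::real))"
proof -
  have "filterlim (\<lambda>\<delta>. - ln \<delta>) at_top (at_right (0::real))"
    using ln_at_0 by (simp add: filterlim_uminus_at_top[of ln] filterlim_uminus_at_bot)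
  then have "filterlim (\<lambda>\<delta>. - ln \<delta>) at_infinity (at_right (0::real))"
    by (rule filterlim_at_top_imp_at_infinity)
  from tendsto_add[OF tendsto_const tendsto_divide_0[OF tendsto_const this]]
  show ?thesis by simp
qed

text \<open>Geometric scales suffice: between consecutive powers of \<open>b\<close> the covering number is monotone, and the
loss of a bounded factor disappears after division by \<open>- ln \<delta>\<close>.\<close>

lemma upper_box_dim_le:
  fixes E :: "(real^'n) set"
  assumes E: "bounded E" and b: "b > 1" and t: "t \<ge> 0"
    and N: "\<And>k. real (covering_number (1 / b ^ k) E) \<le> C * (b powr t) ^ k"
  shows "upper_box_dim E \<le> ereal t"
proof -
  define K where "K = max 1 C * b powr t"
  have K: "K \<ge> 1" using b t unfolding K_def
    by (intro order_trans[OF _ mult_mono[of 1 "max 1 C" 1 "b powr t"]] ge_one_powr_ge_zero) auto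
  have bound: "ln (real (covering_number \<delta> E)) / (- ln \<delta>) \<le> t + ln K / (- ln \<delta>)"
    if \<delta>: "0 < \<delta>" "\<delta> < 1" for \<delta>
  proof -
    obtain k where k: "b ^ k \<le> 1 / \<delta>" "1 / \<delta> < b ^ Suc k"
      using power_scale[OF b \<delta>] by blast
    have le: "1 / b ^ Suc k \<le> \<delta>" using k(2) \<delta> b by (simp add: field_simps)
    have "real (covering_number \<delta> E) \<le> real (covering_number (1 / b ^ Suc k) E)"
      using covering_number_mono[OF E order_refl _ le] b by simp
    also have "\<dots> \<le> C * (b powr t) ^ Suc k" by (rule N)
    also have "\<dots> \<le> max 1 C * (b powr t) ^ Suc k" by (intro mult_right_mono) auto
    also have "\<dots> = K * (b ^ k) powr t"
      using b by (simp add: K_def powr_realpow[symmetric] powr_powr mult.commute)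
    also have "\<dots> \<le> K * (1 / \<delta>) powr t"
      using K k(1) b t by (intro mult_left_mono powr_mono2) auto
    finally have *: "real (covering_number \<delta> E) \<le> K * (1 / \<delta>) powr t" .
    have pos: "K * (1 / \<delta>) powr t \<ge> 1"
    proof -
      have "(1 / \<delta>) powr t \<ge> 1" using \<delta> t by (intro ge_one_powr_ge_zero) auto
      then show ?thesis using K mult_mono[of 1 K 1 "(1 / \<delta>) powr t"] by simp
    qed
    have "ln (real (covering_number \<delta> E)) \<le> ln (K * (1 / \<delta>) powr t)"
      using * pos by (cases "covering_number \<delta> E = 0") auto
    also have "\<dots> = ln K + t * (- ln \<delta>)"
      using K \<delta> by (simp add: ln_mult ln_powr ln_div)
    finally have "ln (real (covering_number \<delta> E)) / (- ln \<delta>) \<le> (ln K + t * (- ln \<delta>)) / (- ln \<delta>)"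
      using \<delta> by (intro divide_right_mono) auto
    then show ?thesis using \<delta> by (simp add: add_divide_distrib diff_divide_distrib)
  qed
  have "upper_box_dim E \<le> Limsup (at_right 0) (\<lambda>\<delta>. ereal (t + ln K / (- ln \<delta>)))"
    unfolding upper_box_dim_def
    by (intro Limsup_mono) (use bound in \<open>auto simp del: divide_minus_right simp: eventually_at_right_field intro!: exI[of _ 1]\<close>)
  also have "\<dots> = ereal t"
    by (intro lim_imp_Limsup tendsto_ereal tendsto_add_const_over_log) simp
  finally show ?thesis .
qed

lemma lower_box_dim_ge:
  fixes E :: "(real^'n) set"
  assumes E: "bounded E" and b: "b > 1" and t: "t \<ge> 0" and C: "C > 0"
    and N: "\<And>k. real (covering_number (1 / b ^ k) E) \<ge> C * (b powr t) ^ k"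
  shows "lower_box_dim E \<ge> ereal t"
proof -
  define K where "K = C / b powr t"
  have K: "K > 0" using b C unfolding K_def by simp
  have bound: "ln (real (covering_number \<delta> E)) / (- ln \<delta>) \<ge> t + ln K / (- ln \<delta>)"
    if \<delta>: "0 < \<delta>" "\<delta> < 1" for \<delta>
  proof -
    obtain k where k: "b ^ k \<le> 1 / \<delta>" "1 / \<delta> < b ^ Suc k"
      using power_scale[OF b \<delta>] by blast
    have le: "\<delta> \<le> 1 / b ^ k" using k(1) \<delta> b by (simp add: field_simps)
    have "K * (1 / \<delta>) powr t \<le> K * (b ^ Suc k) powr t"
      using K k(2) \<delta> t by (intro mult_left_mono powr_mono2) auto
    also have "\<dots> = C * (b powr t) ^ k"
      using b by (simp add: K_def powr_realpow[symmetric] powr_powr mult.commute powr_mult)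
    also have "\<dots> \<le> real (covering_number (1 / b ^ k) E)" by (rule N)
    also have "\<dots> \<le> real (covering_number \<delta> E)"
      using covering_number_mono[OF E order_refl \<delta>(1) le] by simp
    finally have *: "K * (1 / \<delta>) powr t \<le> real (covering_number \<delta> E)" .
    have "ln K + t * (- ln \<delta>) = ln (K * (1 / \<delta>) powr t)"
      using K \<delta> by (simp add: ln_mult ln_powr ln_div)
    also have "\<dots> \<le> ln (real (covering_number \<delta> E))"
      using * K \<delta> by (intro ln_mono) (auto intro: less_le_trans[OF _ *])
    finally have "(ln K + t * (- ln \<delta>)) / (- ln \<delta>) \<le> ln (real (covering_number \<delta> E)) / (- ln \<delta>)"
      using \<delta> by (intro divide_right_mono) auto
    then show ?thesis using \<delta> by (simp add: add_divide_distrib diff_divide_distrib)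
  qed
  have "ereal t = Liminf (at_right 0) (\<lambda>\<delta>. ereal (t + ln K / (- ln \<delta>)))"
    by (rule lim_imp_Liminf[symmetric], simp, intro tendsto_ereal tendsto_add_const_over_log)
  also have "\<dots> \<le> lower_box_dim E"
    unfolding lower_box_dim_def
    by (intro Liminf_mono) (use bound in \<open>auto simp del: divide_minus_right simp: eventually_at_right_field intro!: exI[of _ 1]\<close>)
  finally show ?thesis .
qed

lemma box_dims_eqI:
  fixes E :: "(real^'n) set"
  assumes "ereal t \<le> lower_box_dim E" "upper_box_dim E \<le> ereal t"
  shows "lower_box_dim E = ereal t" "upper_box_dim E = ereal t" "box_dim E = ereal t"
proof -
  have "lower_box_dim E \<le> upper_box_dim E"
    unfolding lower_box_dim_def upper_box_dim_def by (rule Liminf_le_Limsup) simp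
  with assms show 1: "lower_box_dim E = ereal t" "upper_box_dim E = ereal t" by auto
  then show "box_dim E = ereal t" unfolding box_dim_def by (intro the_equality) auto
qed

section \<open>Line segments\<close>

text \<open>The first and the second axis projection of the sponge are segments of this form.\<close>

definition unit_segment :: "'n::finite \<Rightarrow> (real^'n) set" where
  "unit_segment j = {x. 0 \<le> x $ j \<and> x $ j \<le> 1 \<and> (\<forall>k. k \<noteq> j \<longrightarrow> x $ k = 0)}"

lemma bounded_unit_segment: "bounded (unit_segment j)"
  by (rule bounded_subset[OF bounded_cbox[of 0 "vec 1"]])
     (auto simp: unit_segment_def mem_box_cart, (metis order_refl zero_le_one)+)

lemma covering_number_unit_segment_le:
  assumes "\<delta> > 0"
  shows "real (covering_number \<delta> (unit_segment j :: (real^'n) set)) \<le> 1 / \<delta> + 1"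
  by (rule covering_number_slab_le[where m = j and l = 0])
     (use assms in \<open>auto simp: unit_segment_def\<close>)

lemma covering_number_ball_unit_segment_le:
  fixes x :: "real^'n"
  assumes "r > 0" "R > 0"
  shows "real (covering_number r (ball x R \<inter> unit_segment j)) \<le> 2 * R / r + 1"
proof (rule covering_number_slab_le[where m = j and l = "axis j (x $ j - R)"])
  fix y assume y: "y \<in> ball x R \<inter> unit_segment j"
  then have "\<bar>x $ j - y $ j\<bar> < R"
    using dist_vec_nth_le[of x j y] by (simp add: dist_real_def)
  then show "axis j (x $ j - R) $ j \<le> y $ j \<and> y $ j \<le> axis j (x $ j - R) $ j + 2 * R"
    unfolding axis_nth abs_less_iff by linarith
  show "axis j (x $ j - R) $ k \<le> y $ k \<and> y $ k \<le> axis j (x $ j - R) $ k + r" if "k \<noteq> j" for k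
    using that y assms by (simp add: unit_segment_def axis_def)
qed (use assms in auto)

lemma covering_number_ball_unit_segment_ge:
  fixes j :: "'n::finite"
  assumes "r > 0" "0 < R" "R \<le> 1"
  shows "R / 2 \<le> real (covering_number r (ball (0::real^'n) R \<inter> unit_segment j)) * r"
proof -
  let ?E = "ball (0::real^'n) R \<inter> unit_segment j"
  have "bounded ?E" by (simp add: bounded_Int)
  then obtain T where T: "finite T" "card T = covering_number r ?E"
    "?E \<subseteq> (\<Union>a\<in>T. cbox a (a + vec r))"
    using optimal_cube_cover assms(1) by blast
  have "{0..R / 2} \<subseteq> (\<lambda>x. x $ j) ` ?E"
  proof
    fix t assume "t \<in> {0..R / 2}"
    have "axis j t = t *\<^sub>R axis j 1" by (simp add: vec_eq_iff axis_def)
    then have "norm (axis j t) < R" using assms \<open>t \<in> _\<close> by simp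
    moreover have "\<forall>k. k \<noteq> j \<longrightarrow> axis j t $ k = 0" by (simp add: axis_def)
    ultimately have "axis j t \<in> ?E" "t = axis j t $ j"
      using assms \<open>t \<in> _\<close> by (auto simp: unit_segment_def)
    then show "t \<in> (\<lambda>x. x $ j) ` ?E" by blast
  qed
  from interval_length_le_card_cover[OF T(1,3) _ this] T(2) assms(1) show ?thesis by simp
qed

lemma covering_number_unit_segment_ge:
  assumes "r > 0"
  shows "1 \<le> real (covering_number r (unit_segment j :: (real^'n) set)) * r"
proof -
  obtain T where T: "finite T" "card T = covering_number r (unit_segment j :: (real^'n) set)"
    "(unit_segment j :: (real^'n) set) \<subseteq> (\<Union>a\<in>T. cbox a (a + vec r))"
    using optimal_cube_cover[OF bounded_unit_segment assms] by blast
  have "{0..1} \<subseteq> (\<lambda>x. x $ j) ` (unit_segment j :: (real^'n) set)"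
  proof
    fix t :: real assume "t \<in> {0..1}"
    then have "axis j t \<in> (unit_segment j :: (real^'n) set)" "t = axis j t $ j"
      by (auto simp: unit_segment_def) (simp add: axis_def)
    then show "t \<in> (\<lambda>x. x $ j) ` (unit_segment j :: (real^'n) set)" by blast
  qed
  from interval_length_le_card_cover[OF T(1,3) _ this] T(2) assms show ?thesis by simp
qed

lemma box_dim_unit_segment: "box_dim (unit_segment j :: (real^'n) set) = 1"
proof -
  let ?E = "unit_segment j :: (real^'n) set"
  have "upper_box_dim ?E \<le> ereal 1"
  proof (rule upper_box_dim_le[of _ 2 1 2])
    fix k :: nat
    have "real (covering_number (1 / 2 ^ k) ?E) \<le> 2 ^ k + 1"
      using covering_number_unit_segment_le[of "1 / 2 ^ k" j] by simp
    then show "real (covering_number (1 / 2 ^ k) ?E) \<le> 2 * (2 powr 1) ^ k"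
      using one_le_power[of "2::real" k] by (simp del: one_le_power)
  qed (auto simp: bounded_unit_segment)
  moreover have "ereal 1 \<le> lower_box_dim ?E"
  proof (rule lower_box_dim_ge[of _ 2 1 1])
    fix k :: nat
    show "1 * (2 powr 1) ^ k \<le> real (covering_number (1 / 2 ^ k) ?E)"
      using covering_number_unit_segment_ge[of "1 / 2 ^ k" j] by (simp add: field_simps)
  qed (auto simp: bounded_unit_segment)
  ultimately show ?thesis using box_dims_eqI(3) by (simp add: one_ereal_def)
qed

text \<open>The exponent 1 is admissible because \<open>r \<le> R\<close>. A smaller exponent \<open>\<alpha>\<close> fails already for the fixed
radius \<open>R = 1/2\<close>: the covering number grows like \<open>X = R/r\<close> as \<open>r\<close> tends to 0, faster than \<open>X\<^sup>\<alpha>\<close>. The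
gap condition only forces \<open>X \<ge> 2\<^sup>\<epsilon>\<close> there.\<close>

lemma assouad_gap_dim_unit_segment:
  assumes \<epsilon>: "\<epsilon> > 0"
  shows "assouad_gap_dim (unit_segment j :: (real^'n) set) \<epsilon> = 1"
proof -
  let ?E = "unit_segment j :: (real^'n) set"
  define A where "A = {\<alpha>. \<exists>C>0. \<forall>r R. \<forall>x\<in>?E.
     0 < r \<and> 0 < R \<and> r \<le> R powr (1 + \<epsilon>) \<and> R powr (1 + \<epsilon>) < 1 \<longrightarrow>
       real (covering_number r (ball x R \<inter> ?E)) \<le> C * (R / r) powr \<alpha>}"
  have "1 \<in> A"
    unfolding A_def
  proof (intro CollectI exI[of _ 3] conjI allI ballI impI)
    fix r R :: real and x :: "real^'n"
    assume "0 < r \<and> 0 < R \<and> r \<le> R powr (1 + \<epsilon>) \<and> R powr (1 + \<epsilon>) < 1"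
    then have h: "0 < r" "0 < R" "r \<le> R powr (1 + \<epsilon>)" "R powr (1 + \<epsilon>) < 1" by auto
    have "R < 1" using h ge_one_powr_ge_zero[of R "1 + \<epsilon>"] \<epsilon> by (cases "R < 1") auto
    then have "R powr (1 + \<epsilon>) \<le> R powr 1" using h(2) \<epsilon> by (intro powr_mono') auto
    then have "1 \<le> R / r" using h by simp
    moreover have "3 * (R / r) powr 1 = 2 * R / r + R / r" using h by simp
    ultimately show "real (covering_number r (ball x R \<inter> ?E)) \<le> 3 * (R / r) powr 1"
      using covering_number_ball_unit_segment_le[OF h(1,2), of x j] by linarith
  qed simp
  moreover have "1 \<le> \<alpha>" if "\<alpha> \<in> A" for \<alpha>
  proof (rule ccontr)
    assume "\<not> 1 \<le> \<alpha>"
    then have \<alpha>: "\<alpha> < 1" by simp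
    obtain C where C: "C > 0" and bound: "\<And>r R x. x \<in> ?E \<Longrightarrow>
       0 < r \<Longrightarrow> 0 < R \<Longrightarrow> r \<le> R powr (1 + \<epsilon>) \<Longrightarrow> R powr (1 + \<epsilon>) < 1 \<Longrightarrow>
       real (covering_number r (ball x R \<inter> ?E)) \<le> C * (R / r) powr \<alpha>"
      using \<open>\<alpha> \<in> A\<close> unfolding A_def by blast
    \<comment> \<open>The first term of the maximum makes the pair of scales admissible, the second one
      violates the bound.\<close>
    define X where "X = max (2 powr \<epsilon>) ((2 * C + 1) powr (1 / (1 - \<alpha>)))"
    define r where "r = (1/2) / X"
    have X: "X \<ge> 2 powr \<epsilon>" "X > 0" by (auto simp: X_def less_max_iff_disj)
    have r: "r > 0" "(1/2) / r = X" using X by (auto simp: r_def)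
    have half: "(1/2) powr (1 + \<epsilon>) = (1/2) / 2 powr \<epsilon>"
      by (simp add: powr_add powr_divide)
    have le: "r \<le> (1/2) powr (1 + \<epsilon>)"
      unfolding half r_def using X by (intro divide_left_mono) auto
    have lt: "(1/2) powr (1 + \<epsilon>) < 1"
      unfolding half using ge_one_powr_ge_zero[of 2 \<epsilon>] \<epsilon> by simp
    have "0 \<in> ?E" by (simp add: unit_segment_def)
    from bound[OF this r(1) _ le lt]
    have up: "real (covering_number r (ball 0 (1/2) \<inter> ?E)) \<le> C * X powr \<alpha>" using r by simp
    have "(1/2) / 2 / r \<le> real (covering_number r (ball 0 (1/2) \<inter> ?E))"
      using covering_number_ball_unit_segment_ge[OF r(1), of "1/2" j] r(1) by (simp add: field_simps)
    also have "(1/2) / 2 / r = X / 2" using r by (simp add: field_simps)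
    finally have "X \<le> 2 * C * X powr \<alpha>" using up by simp
    then have "X / X powr \<alpha> \<le> 2 * C" using X by (simp add: field_simps)
    then have "X powr (1 - \<alpha>) \<le> 2 * C" using X by (simp add: powr_diff)
    moreover have "2 * C + 1 \<le> X powr (1 - \<alpha>)"
    proof -
      have "2 * C + 1 = ((2 * C + 1) powr (1 / (1 - \<alpha>))) powr (1 - \<alpha>)"
        using \<alpha> C by (simp add: powr_powr)
      also have "\<dots> \<le> X powr (1 - \<alpha>)" using \<alpha> by (intro powr_mono2) (auto simp: X_def)
      finally show ?thesis .
    qed
    ultimately show False by simp
  qed
  ultimately have "Inf (ereal ` A) = 1"
    by (intro antisym Inf_greatest Inf_lower) (auto simp: one_ereal_def)
  then show ?thesis by (simp add: assouad_gap_dim_def A_def)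
qed

lemma quasi_assouad_dim_unit_segment: "quasi_assouad_dim (unit_segment j :: (real^'n) set) = 1"
proof -
  have "eventually (\<lambda>\<epsilon>. assouad_gap_dim (unit_segment j :: (real^'n) set) \<epsilon> = 1) (at_right 0)"
    by (auto simp: eventually_at_right_field assouad_gap_dim_unit_segment intro!: exI[of _ 1])
  then have "(assouad_gap_dim (unit_segment j :: (real^'n) set) \<longlongrightarrow> 1) (at_right 0)"
    by (rule tendsto_eventually)
  then show ?thesis unfolding quasi_assouad_dim_def by (intro tendsto_Lim) auto
qed

lemma axis_proj_eq_unit_segment:
  assumes "F \<subseteq> cbox 0 (vec 1)" "{0..1} \<subseteq> (\<lambda>x. x $ j) ` F"
  shows "axis_proj j ` F = unit_segment j"
proof
  show "axis_proj j ` F \<subseteq> unit_segment j"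
    using assms(1) by (auto simp: axis_proj_def unit_segment_def mem_box_cart subset_iff)
  show "unit_segment j \<subseteq> axis_proj j ` F"
  proof
    fix x :: "real^3" assume x: "x \<in> unit_segment j"
    then have "x $ j \<in> {0..1}" by (simp add: unit_segment_def)
    then obtain y where "y \<in> F" "x $ j = y $ j" using assms(2) by (meson imageE subsetD)
    moreover then have "x = axis_proj j y" using x by (auto simp: axis_proj_def unit_segment_def vec_eq_iff)
    ultimately show "x \<in> axis_proj j ` F" by blast
  qed
qed

section \<open>Diagonal affine maps\<close>

definition diag_affine :: "real^'n \<Rightarrow> real^'n \<Rightarrow> real^'n \<Rightarrow> real^'n" where
  "diag_affine r t x = (\<chi> j. r $ j * x $ j + t $ j)"

lemma diag_affine_nth [simp]: "diag_affine r t x $ j = r $ j * x $ j + t $ j"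
  by (simp add: diag_affine_def)

lemma linear_diag_affine: "linear (\<lambda>x. diag_affine r t x - diag_affine r t 0)"
  by (rule linearI) (auto simp: vec_eq_iff algebra_simps)

lemma linear_part_diag_affine:
  "linear_part (diag_affine r t) = (\<chi> i j. if i = j then r $ i else 0)"
  by (auto simp: linear_part_def matrix_def vec_eq_iff axis_def)

lemma lipschitz_diag_affine:
  assumes "0 \<le> c" "\<And>j. \<bar>r $ j\<bar> \<le> c"
  shows "c-lipschitz_on UNIV (diag_affine r t)"
proof (rule lipschitz_onI)
  fix x y :: "real^'a"
  have "norm (diag_affine r t x - diag_affine r t y) \<le> norm (c *\<^sub>R (x - y))"
    using assms
    by (intro norm_le_componentwise_cart)
       (auto simp: abs_mult right_diff_distrib[symmetric] intro!: mult_right_mono)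
  then show "dist (diag_affine r t x) (diag_affine r t y) \<le> c * dist x y"
    using assms(1) by (simp add: dist_norm)
qed (use assms in auto)

lemma generalised_permutation_diag_affine:
  assumes "\<And>j. r $ j \<noteq> 0"
  shows "generalised_permutation_matrix (linear_part (diag_affine r t))"
  using assms by (auto simp: generalised_permutation_matrix_def linear_part_diag_affine)

lemma inj_diag_affine:
  assumes "\<And>j. r $ j \<noteq> 0"
  shows "inj (diag_affine r t)"
  using assms by (auto simp: inj_def vec_eq_iff)

lemma word_map_diag_affine_nth:
  "word_map (\<lambda>i. diag_affine (r i) (t i)) w x $ j =
     prod_list (map (\<lambda>i. r i $ j) w) * x $ j + word_map (\<lambda>i. diag_affine (r i) (t i)) w 0 $ j"
proof (induction w)
  case (Cons i w)
  show ?case by (simp add: Cons algebra_simps)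
qed simp

lemma word_map_diag_affine:
  "word_map (\<lambda>i. diag_affine (r i) (t i)) w =
     diag_affine (\<chi> j. prod_list (map (\<lambda>i. r i $ j) w)) (word_map (\<lambda>i. diag_affine (r i) (t i)) w 0)"
  by (rule ext, subst vec_eq_iff) (subst word_map_diag_affine_nth, simp)

lemma edge_length_diag_affine:
  assumes "word_map S w = diag_affine r t" "r $ j \<ge> 0"
  shows "edge_length S w j = r $ j"
proof -
  have "(\<lambda>x. x $ j) ` diag_affine r t ` cbox 0 (vec 1) = {t $ j..r $ j + t $ j}" (is "?A = ?B")
  proof
    show "?A \<subseteq> ?B"
      using assms(2) by (auto simp: mem_box_cart mult_left_le)
    show "?B \<subseteq> ?A"
    proof
      fix y assume y: "y \<in> ?B"
      define s where "s = (if r $ j = 0 then 0 else (y - t $ j) / r $ j)"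
      have s: "0 \<le> s" "s \<le> 1" "y = r $ j * s + t $ j"
        using y assms(2) by (auto simp: s_def divide_simps)
      then have "vec s \<in> cbox (0::real^3) (vec 1)" "y = diag_affine r t (vec s) $ j"
        by (auto simp: mem_box_cart)
      then show "y \<in> ?A" by blast
    qed
  qed
  then show ?thesis using assms by (simp add: edge_length_def diameter_closed_interval)
qed

text \<open>The list is described by its characteristic polynomial only, so uniqueness has to be recovered: the
largest root of a cubic is determined by the polynomial, and the two others by their sum and product.\<close>

lemma singular_values_eqI:
  fixes A :: "real^3^3"
  assumes ord: "p \<ge> q" "q \<ge> r" "r \<ge> 0"
    and char: "\<And>x. det (mat x - transpose A ** A) = (x - p\<^sup>2) * (x - q\<^sup>2) * (x - r\<^sup>2)"
  shows "singular_values A = [p, q, r]"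
  unfolding singular_values_def
proof (rule the_equality, goal_cases)
  case 1
  then show ?case using ord by (simp add: char)
next
  case (2 \<sigma>)
  then obtain p' q' r' where \<sigma>: "\<sigma> = [p', q', r']"
    by (auto simp: eval_nat_numeral length_Suc_conv)
  have o: "p' \<ge> q'" "q' \<ge> r'" "r' \<ge> 0" using 2 \<sigma> by auto
  have eq: "(x - p\<^sup>2) * (x - q\<^sup>2) * (x - r\<^sup>2) = (x - p'\<^sup>2) * (x - q'\<^sup>2) * (x - r'\<^sup>2)" for x
    using 2 \<sigma> char[of x] by simp
  have sq: "q\<^sup>2 \<le> p\<^sup>2" "r\<^sup>2 \<le> q\<^sup>2" "q'\<^sup>2 \<le> p'\<^sup>2" "r'\<^sup>2 \<le> q'\<^sup>2"
    using o ord by (auto intro!: power_mono)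
  have pp: "p\<^sup>2 = p'\<^sup>2"
    using eq[of "p\<^sup>2"] eq[of "p'\<^sup>2"] sq by auto
  have cancel: "(x - q\<^sup>2) * (x - r\<^sup>2) = (x - q'\<^sup>2) * (x - r'\<^sup>2)" if "x \<noteq> p\<^sup>2" for x
    using eq[of x] that unfolding pp[symmetric] by (simp add: mult.assoc)
  \<comment> \<open>Three points different from the common root determine the remaining quadratic factor.\<close>
  have "(p\<^sup>2 + 1 - q\<^sup>2) * (p\<^sup>2 + 1 - r\<^sup>2) = (p\<^sup>2 + 1 - q'\<^sup>2) * (p\<^sup>2 + 1 - r'\<^sup>2)"
       "(p\<^sup>2 - 1 - q\<^sup>2) * (p\<^sup>2 - 1 - r\<^sup>2) = (p\<^sup>2 - 1 - q'\<^sup>2) * (p\<^sup>2 - 1 - r'\<^sup>2)"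
       "(p\<^sup>2 + 2 - q\<^sup>2) * (p\<^sup>2 + 2 - r\<^sup>2) = (p\<^sup>2 + 2 - q'\<^sup>2) * (p\<^sup>2 + 2 - r'\<^sup>2)"
    by (rule cancel; simp)+
  then have sums: "q\<^sup>2 + r\<^sup>2 = q'\<^sup>2 + r'\<^sup>2" "q\<^sup>2 * r\<^sup>2 = q'\<^sup>2 * r'\<^sup>2"
    by (simp_all add: algebra_simps) algebra+
  then have "(q\<^sup>2 - q'\<^sup>2) * (q\<^sup>2 - r'\<^sup>2) = 0" by algebra
  then have "q\<^sup>2 = q'\<^sup>2" using sums sq by auto
  with sums pp have "p\<^sup>2 = p'\<^sup>2" "q\<^sup>2 = q'\<^sup>2" "r\<^sup>2 = r'\<^sup>2" by auto
  then show ?case using o ord \<sigma> by (simp add: power2_eq_iff_nonneg)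
qed

lemma singular_values_diag:
  fixes d :: "real^3"
  assumes "p \<ge> q" "q \<ge> r" "r \<ge> 0"
    and "\<And>x. (x - (d$1)\<^sup>2) * (x - (d$2)\<^sup>2) * (x - (d$3)\<^sup>2) = (x - p\<^sup>2) * (x - q\<^sup>2) * (x - r\<^sup>2)"
  shows "singular_values (\<chi> i j. if i = j then d $ i else 0) = [p, q, r]"
proof (rule singular_values_eqI[OF assms(1-3)])
  fix x :: real
  let ?D = "\<chi> i j. if i = j then d $ i else 0"
  have "mat x - transpose ?D ** ?D = (\<chi> i j. if i = j then x - (d$i)\<^sup>2 else 0)"
    by (auto simp: vec_eq_iff mat_def transpose_def matrix_matrix_mult_def forall_3 sum_3 power2_eq_square)
  then have "det (mat x - transpose ?D ** ?D) = (\<Prod>i\<in>UNIV. x - (d$i)\<^sup>2)"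
    by (simp add: det_diagonal)
  also have "\<dots> = (x - (d$1)\<^sup>2) * (x - (d$2)\<^sup>2) * (x - (d$3)\<^sup>2)"
    unfolding UNIV_3 by (simp add: mult.assoc)
  also note assms(4)
  finally show "det (mat x - transpose ?D ** ?D) = (x - p\<^sup>2) * (x - q\<^sup>2) * (x - r\<^sup>2)" .
qed

section \<open>Words and attractors\<close>

lemma words_0: "words I 0 = {[]}"
  by (auto simp: words_def)

lemma words_Suc: "words I (Suc k) = (\<lambda>(i, w). i # w) ` (I \<times> words I k)"
  by (auto simp: words_def length_Suc_conv image_iff)

lemma UN_words_Suc: "(\<Union>w\<in>words I (Suc k). f w) = (\<Union>i\<in>I. \<Union>w\<in>words I k. f (i # w))"
  unfolding words_Suc by fastforce

lemma finite_words: "finite I \<Longrightarrow> finite (words I k)"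
  using finite_lists_length_eq[of I k] by (simp add: words_def)

lemma sum_words_Suc:
  "(\<Sum>w\<in>words I (Suc k). g w) = (\<Sum>i\<in>I. \<Sum>w\<in>words I k. g (i # w))"
  unfolding words_Suc
  by (subst sum.reindex) (auto simp: inj_on_def sum.cartesian_product intro!: sum.cong)

lemma sum_words_prod_list:
  fixes f :: "'i \<Rightarrow> 'a::comm_semiring_1"
  shows "(\<Sum>w\<in>words I k. prod_list (map f w)) = (\<Sum>i\<in>I. f i) ^ k"
  by (induction k)
     (auto simp: words_0 sum_words_Suc sum_distrib_left[symmetric] sum_distrib_right[symmetric])

lemma card_words: "finite I \<Longrightarrow> card (words I k) = card I ^ k"
  using card_lists_length_eq[of I k] by (simp add: words_def)

text \<open>Existence by compactness: the images of \<open>Q\<close> under iteration of the union map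
decrease, and their intersection \<open>F\<close> is nonempty by compactness. A point of \<open>F\<close> lies, at every level, in
the image under some map; one map occurs infinitely often, and since it is injective the preimage is
the same point at all levels, hence in \<open>F\<close>.\<close>

lemma attractor_exists:
  fixes S :: "'i \<Rightarrow> real^3 \<Rightarrow> real^3"
  assumes I: "finite I" "I \<noteq> {}" and Q: "compact Q" "Q \<noteq> {}"
    and S: "\<And>i. i \<in> I \<Longrightarrow> continuous_on UNIV (S i)" "\<And>i. i \<in> I \<Longrightarrow> inj (S i)"
      "\<And>i. i \<in> I \<Longrightarrow> S i ` Q \<subseteq> Q"
  obtains F where "is_attractor I S F" "F \<subseteq> Q"
proof -
  define H where "H X = (\<Union>i\<in>I. S i ` X)" for X
  define G where "G k = (H ^^ k) Q" for k
  have Hmono: "H X \<subseteq> H Y" if "X \<subseteq> Y" for X Y using that by (auto simp: H_def)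
  have GSuc: "G (Suc k) = H (G k)" for k by (simp add: G_def)
  have dec1: "G (Suc k) \<subseteq> G k" for k
  proof (induction k)
    case 0
    then show ?case using S(3) by (auto simp: G_def H_def)
  next
    case (Suc k)
    then show ?case using Hmono GSuc by metis
  qed
  have dec: "G m \<subseteq> G n" if "n \<le> m" for m n
    using lift_Suc_antimono_le[of G, OF dec1 that] .
  have G: "compact (G k) \<and> G k \<noteq> {}" for k
  proof (induction k)
    case 0
    then show ?case using Q by (simp add: G_def)
  next
    case (Suc k)
    have "compact (S i ` G k)" if "i \<in> I" for i
      using S(1)[OF that] Suc by (meson compact_continuous_image continuous_on_subset subset_UNIV)
    then have "compact (H (G k))" unfolding H_def by (intro compact_UN I) auto
    then show ?case using Suc I by (auto simp: GSuc H_def)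
  qed
  define F where "F = (\<Inter>k. G k)"
  have ne: "F \<noteq> {}" unfolding F_def using G dec by (intro compact_nest) auto
  have "compact F" unfolding F_def using G by (intro compact_Inter) auto
  moreover have "F = (\<Union>i\<in>I. S i ` F)"
  proof
    show "(\<Union>i\<in>I. S i ` F) \<subseteq> F"
    proof -
      have "H F \<subseteq> G k" for k
        using Hmono[of F "G k"] dec1[of k] GSuc[of k] by (auto simp: F_def)
      then show ?thesis by (auto simp: F_def H_def)
    qed
    show "F \<subseteq> (\<Union>i\<in>I. S i ` F)"
    proof
      fix x assume "x \<in> F"
      then have "x \<in> H (G k)" for k using GSuc by (auto simp: F_def)
      then have "\<exists>i. i \<in> I \<and> x \<in> S i ` G k" for k unfolding H_def by blast
      then obtain c where c: "\<And>k. c k \<in> I" "\<And>k. x \<in> S (c k) ` G k" by metis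
      have "finite (range c)" using I(1) c(1) by (meson finite_subset image_subsetI)
      then obtain i where i: "i \<in> range c" "infinite (c -` {i})"
        using inf_img_fin_dom[of c UNIV] by auto
      then have iI: "i \<in> I" using c(1) by auto
      have "x \<in> S i ` G k" for k
      proof -
        obtain n where "n \<ge> k" "c n = i"
          using i(2) unfolding infinite_nat_iff_unbounded_le by auto
        then show ?thesis using c(2)[of n] dec[of k n] by auto
      qed
      then have "\<forall>k. \<exists>y. y \<in> G k \<and> x = S i y" by blast
      then obtain y where y: "\<And>k. y k \<in> G k" "\<And>k. x = S i (y k)" by metis
      have "y k = y 0" for k using S(2)[OF iI] y(2) by (metis injD)
      then have "y 0 \<in> F" using y(1) unfolding F_def by (metis INT_I)
      then show "x \<in> (\<Union>i\<in>I. S i ` F)" using y(2)[of 0] iI by blast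
    qed
  qed
  moreover have "F \<subseteq> Q" unfolding F_def using G_def by (metis INF_lower UNIV_I funpow_0)
  ultimately show ?thesis using that ne by (simp add: is_attractor_def)
qed

lemma attractor_words:
  assumes "is_attractor I S F"
  shows "F = (\<Union>w\<in>words I k. word_map S w ` F)"
proof (induction k)
  case 0
  then show ?case by (simp add: words_0)
next
  case (Suc k)
  have "F = (\<Union>i\<in>I. S i ` F)" using assms by (simp add: is_attractor_def)
  also have "\<dots> = (\<Union>i\<in>I. S i ` (\<Union>w\<in>words I k. word_map S w ` F))"
    by (simp only: Suc.IH[symmetric])
  also have "\<dots> = (\<Union>w\<in>words I (Suc k). word_map S w ` F)"
    by (simp add: UN_words_Suc image_UN image_comp)
  finally show ?case .
qed

text \<open>A point of the unit interval at maximal distance from the projection has a preimage under one of the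
one-dimensional maps, whose distance is no larger; since the map contracts distances by at least
the factor \<open>c < 1\<close>, the maximal distance is 0.\<close>

lemma attractor_coordinate_full:
  fixes S :: "'i \<Rightarrow> real^3 \<Rightarrow> real^3"
  assumes F: "is_attractor I S F" and c: "c < 1"
    and S: "\<And>i x. i \<in> I \<Longrightarrow> S i x $ j = r i * x $ j + t i"
      "\<And>i. i \<in> I \<Longrightarrow> 0 \<le> r i \<and> r i \<le> c"
    and cover: "\<And>y. y \<in> {0..1} \<Longrightarrow> \<exists>i\<in>I. \<exists>z\<in>{0..1}. y = r i * z + t i"
  shows "{0..1} \<subseteq> (\<lambda>x. x $ j) ` F"
proof
  define K where "K = (\<lambda>x. x $ j) ` F"
  have "compact K" unfolding K_def using F
    by (intro compact_continuous_image continuous_intros) (simp add: is_attractor_def)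
  then have K: "closed K" "K \<noteq> {}" using F by (auto simp: compact_imp_closed K_def is_attractor_def)
  obtain y where y: "y \<in> {0..1}" "\<And>y'. y' \<in> {0..1} \<Longrightarrow> infdist y' K \<le> infdist y K"
    using continuous_attains_sup[of "{0..1}" "\<lambda>y. infdist y K"]
    by (fastforce intro!: continuous_on_infdist continuous_on_id)
  obtain i z where iz: "i \<in> I" "z \<in> {0..1}" "y = r i * z + t i" using cover[OF y(1)] by blast
  obtain u where u: "u \<in> K" "infdist z K = dist z u" using infdist_attains_inf[OF K] by blast
  have "r i * u + t i \<in> K"
  proof -
    obtain x where "x \<in> F" "u = x $ j" using u(1) by (auto simp: K_def)
    moreover then have "S i x \<in> F" using F iz(1) by (auto simp: is_attractor_def)
    ultimately show ?thesis using S(1)[OF iz(1), of x] by (force simp: K_def)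
  qed
  then have "infdist y K \<le> dist y (r i * u + t i)" by (rule infdist_le)
  also have "\<dots> = r i * infdist z K"
    using S(2)[OF iz(1)] unfolding u(2) iz(3)
    by (simp add: dist_real_def right_diff_distrib[symmetric] abs_mult)
  also have "\<dots> \<le> c * infdist y K"
    using S(2)[OF iz(1)] y(2)[OF iz(2)] by (intro mult_mono) (auto simp: infdist_nonneg)
  finally have "(1 - c) * infdist y K \<le> 0" by (simp add: algebra_simps)
  then have "infdist y K = 0" using c infdist_nonneg[of y K] by (simp add: mult_le_0_iff)
  then have "infdist y' K = 0" if "y' \<in> {0..1}" for y'
    using y(2)[OF that] infdist_nonneg[of y' K] by simp
  then show "y' \<in> (\<lambda>x. x $ j) ` F" if "y' \<in> {0..1}" for y'
    using that in_closed_iff_infdist_zero[OF K] by (simp add: K_def)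
qed

section \<open>The sponge\<close>

text \<open>The tile \<open>i\<close> lies in column \<open>i div 64\<close> of the first coordinate and in layer \<open>i mod 64\<close> of the third.
Columns 0 and 1 hold 64 flat tiles each, columns 2 and 3 one tall tile each.\<close>

definition tiles :: "nat set" where
  "tiles = {..<128} \<union> {128, 192}"

text \<open>One representative per column; all tiles of a column have the same planar projection.\<close>

definition column_tiles :: "nat set" where
  "column_tiles = {0, 64, 128, 192}"

definition height :: "nat \<Rightarrow> real" where
  "height i = (if i < 128 then 1/16 else 15/16)"

definition ratio :: "nat \<Rightarrow> real^3" where
  "ratio i = vector [1/4, height i, 1/64]"

text \<open>The tile 192 is shifted to the top of its column so that the two tall tiles together project onto
the whole unit interval in the second coordinate.\<close>

definition corner :: "nat \<Rightarrow> real^3" where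
  "corner i = vector [real (i div 64) / 4, if i = 192 then 1/16 else 0, real (i mod 64) / 64]"

definition sponge :: "nat \<Rightarrow> real^3 \<Rightarrow> real^3" where
  "sponge i = diag_affine (ratio i) (corner i)"

abbreviation word_height :: "nat list \<Rightarrow> real" where
  "word_height w \<equiv> prod_list (map height w)"

lemma ratio_nth [simp]: "ratio i $ 1 = 1/4" "ratio i $ 2 = height i" "ratio i $ 3 = 1/64"
  by (simp_all add: ratio_def)

lemma corner_nth [simp]:
  "corner i $ 1 = real (i div 64) / 4" "corner i $ 2 = (if i = 192 then 1/16 else 0)"
  "corner i $ 3 = real (i mod 64) / 64"
  by (simp_all add: corner_def)

lemma sponge_nth [simp]: "sponge i x $ j = ratio i $ j * x $ j + corner i $ j"
  by (simp add: sponge_def)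

lemma ratio_bounds: "0 < ratio i $ j" "ratio i $ j \<le> 15/16"
proof -
  have "\<forall>j. 0 < ratio i $ j \<and> ratio i $ j \<le> 15/16" by (simp add: forall_3 height_def)
  then show "0 < ratio i $ j" "ratio i $ j \<le> 15/16" by auto
qed

lemma finite_tiles: "finite tiles" and card_tiles: "card tiles = 130"
  by (simp_all add: tiles_def)

lemma finite_column_tiles: "finite column_tiles"
  by (simp add: column_tiles_def)

lemma column_tiles_subset: "column_tiles \<subseteq> tiles"
  by (auto simp: column_tiles_def tiles_def)

text \<open>All sums over tiles that occur are of this form, since the tiles differ, up to translation, only in
their height.\<close>

lemma sum_tiles_height: "(\<Sum>i\<in>tiles. g (height i)) = 128 * g (1/16) + 2 * g (15/16)" for g :: "real \<Rightarrow> real"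
proof -
  have "(\<Sum>i\<in>tiles. g (height i)) = (\<Sum>i<128. g (height i)) + (\<Sum>i\<in>{128,192}. g (height i))"
    unfolding tiles_def by (rule sum.union_disjoint) auto
  also have "(\<Sum>i<128. g (height i)) = (\<Sum>i<(128::nat). g (1/16))"
    by (intro sum.cong) (auto simp: height_def)
  finally show ?thesis by (simp add: height_def)
qed

lemma sum_column_tiles_height: "(\<Sum>i\<in>column_tiles. height i) = 2" and card_column_tiles: "card column_tiles = 4"
  by (simp_all add: column_tiles_def height_def)

lemma corner_bounds:
  assumes "i \<in> tiles"
  shows "0 \<le> corner i $ j" "ratio i $ j + corner i $ j \<le> 1"
proof -
  have "i div 64 \<le> 3" "i mod 64 \<le> 63" using assms by (auto simp: tiles_def)
  then have "real (i div 64) \<le> 3" "real (i mod 64) \<le> 63" by simp_all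
  then have "\<forall>j. 0 \<le> corner i $ j \<and> ratio i $ j + corner i $ j \<le> 1"
    by (simp add: forall_3 height_def)
  then show "0 \<le> corner i $ j" "ratio i $ j + corner i $ j \<le> 1" by auto
qed

lemma sponge_unit_cube:
  assumes "i \<in> tiles"
  shows "sponge i ` cbox 0 (vec 1) \<subseteq> cbox 0 (vec 1)" "sponge i ` box 0 (vec 1) \<subseteq> box 0 (vec 1)"
proof -
  have "0 \<le> sponge i x $ j \<and> sponge i x $ j \<le> 1" if x: "0 \<le> x $ j" "x $ j \<le> 1" for x j
  proof -
    have "0 \<le> ratio i $ j * x $ j" "ratio i $ j * x $ j \<le> ratio i $ j"
      using ratio_bounds(1)[of i j] x by (auto intro: mult_left_le)
    then show ?thesis using corner_bounds[OF assms, of j] unfolding sponge_nth by linarith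
  qed
  then show "sponge i ` cbox 0 (vec 1) \<subseteq> cbox 0 (vec 1)" by (auto simp: mem_box_cart simp del: sponge_nth)
  have "0 < sponge i x $ j \<and> sponge i x $ j < 1" if x: "0 < x $ j" "x $ j < 1" for x j
  proof -
    have "0 < ratio i $ j * x $ j" "ratio i $ j * x $ j < ratio i $ j"
      using ratio_bounds(1)[of i j] x by auto
    then show ?thesis using corner_bounds[OF assms, of j] unfolding sponge_nth by linarith
  qed
  then show "sponge i ` box 0 (vec 1) \<subseteq> box 0 (vec 1)" by (auto simp: mem_box_cart simp del: sponge_nth)
qed

lemma sponge_ifs_sponge: "sponge_ifs tiles sponge"
  unfolding sponge_ifs_def
proof (intro conjI ballI)
  fix i assume i: "i \<in> tiles"
  show "affine_map (sponge i)" by (simp add: affine_map_def sponge_def linear_diag_affine)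
  have "(15/16)-lipschitz_on UNIV (sponge i)"
    unfolding sponge_def using ratio_bounds[of i]
    by (intro lipschitz_diag_affine) (auto simp: abs_of_pos)
  then show "\<exists>c<1. c-lipschitz_on UNIV (sponge i)" by (intro exI[of _ "15/16"]) simp
  show "generalised_permutation_matrix (linear_part (sponge i))"
    unfolding sponge_def using ratio_bounds(1)[of i]
    by (intro generalised_permutation_diag_affine) (simp add: less_imp_neq[symmetric])
  show "sponge i ` cbox 0 (vec 1) \<subseteq> cbox 0 (vec 1)" by (rule sponge_unit_cube(1)[OF i])
qed (simp_all add: finite_tiles card_tiles)

lemma diagonal_sponge: "diagonal_matrix (linear_part (sponge i))"
  by (simp add: diagonal_matrix_def sponge_def linear_part_diag_affine)

lemma cosc_sponge: "cosc tiles sponge"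
  unfolding cosc_def
proof (rule exI[of _ 0], rule exI[of _ "vec 1"], intro conjI ballI)
  show "box 0 (vec 1 :: real^3) \<noteq> {}" by (simp add: interval_ne_empty_cart)
  show "sponge i ` box 0 (vec 1) \<subseteq> box 0 (vec 1)" if "i \<in> tiles" for i
    by (rule sponge_unit_cube(2)[OF that])
  show "disjoint_family_on (\<lambda>i. sponge i ` box 0 (vec 1)) tiles"
    unfolding disjoint_family_on_def
  proof (intro ballI impI)
    fix i k assume ik: "i \<in> tiles" "k \<in> tiles" "i \<noteq> k"
    show "sponge i ` box 0 (vec 1) \<inter> sponge k ` box 0 (vec 1) = {}"
    proof (rule ccontr)
      assume "\<not> ?thesis"
      then obtain z where "z \<in> sponge i ` box 0 (vec 1)" "z \<in> sponge k ` box 0 (vec 1)"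
        by blast
      then obtain x y where "z = sponge i x" "z = sponge k y" "x \<in> box 0 (vec 1)" "y \<in> box 0 (vec 1)"
        by blast
      then have xy: "sponge i x = sponge k y" "\<And>j. 0 < x $ j" "\<And>j. x $ j < 1"
        "\<And>j. 0 < y $ j" "\<And>j. y $ j < 1" by (auto simp: mem_box_cart)
      have "sponge i x $ 1 = sponge k y $ 1" "sponge i x $ 3 = sponge k y $ 3" using xy(1) by auto
      then have "\<bar>real (i div 64) - real (k div 64)\<bar> < 1" "\<bar>real (i mod 64) - real (k mod 64)\<bar> < 1"
        using xy(2,3,4,5)[of 1] xy(2,3,4,5)[of 3] by auto
      then have "i div 64 = k div 64" "i mod 64 = k mod 64" by linarith+
      then show False using ik(3) by (metis div_mult_mod_eq)
    qed
  qed
qed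

lemma word_height_pos: "0 < word_height w"
  by (induction w) (auto simp: height_def)

text \<open>Compared with the thickness \<open>64\<^sup>-\<^sup>k\<close> this makes the third edge the shortest one for every nonempty
word.\<close>

lemma word_height_ge: "(1/16) ^ length w \<le> word_height w"
proof (induction w)
  case (Cons i w)
  have "(1/16) * (1/16) ^ length w \<le> height i * word_height w"
    using Cons word_height_pos[of w] by (intro mult_mono) (auto simp: height_def[of i])
  then show ?case by simp
qed simp

definition word_ratio :: "nat list \<Rightarrow> real^3" where
  "word_ratio w = vector [(1/4) ^ length w, word_height w, (1/64) ^ length w]"

lemma word_ratio_nth [simp]:
  "word_ratio w $ 1 = (1/4) ^ length w" "word_ratio w $ 2 = word_height w"
  "word_ratio w $ 3 = (1/64) ^ length w"
  by (simp_all add: word_ratio_def)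

lemma word_ratio_nonneg: "0 \<le> word_ratio w $ j"
proof -
  have "\<forall>j. 0 \<le> word_ratio w $ j" using word_height_pos[of w] by (simp add: forall_3)
  then show ?thesis by blast
qed

lemma word_map_sponge: "word_map sponge w = diag_affine (word_ratio w) (word_map sponge w 0)"
proof -
  have "(\<chi> j. prod_list (map (\<lambda>i. ratio i $ j) w)) = word_ratio w"
    by (simp add: vec_eq_iff forall_3 map_replicate_const)
  then show ?thesis
    using word_map_diag_affine[of ratio corner w] by (simp add: sponge_def[abs_def])
qed

lemma word_map_sponge_nth:
  "word_map sponge w x $ j = word_ratio w $ j * x $ j + word_map sponge w 0 $ j"
  using fun_cong[OF word_map_sponge[of w], of x] by (metis diag_affine_nth)

definition column_word :: "nat list \<Rightarrow> nat list" where
  "column_word w = map (\<lambda>i. 64 * (i div 64)) w"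

lemma column_word_in: "w \<in> words tiles k \<Longrightarrow> column_word w \<in> words column_tiles k"
proof -
  have "64 * (i div 64) \<in> column_tiles" if "i \<in> tiles" for i
  proof -
    have "i div 64 = 0 \<or> i div 64 = 1 \<or> i div 64 = 2 \<or> i div 64 = 3"
      using that by (auto simp: tiles_def)
    then show ?thesis by (auto simp: column_tiles_def)
  qed
  then show "w \<in> words tiles k \<Longrightarrow> column_word w \<in> words column_tiles k"
    by (auto simp: words_def column_word_def)
qed

text \<open>Layers are invisible in the plane, so planar pieces may be indexed by column words; this avoids
counting each of them many times.\<close>

lemma column_word_planar:
  assumes "w \<in> words tiles k" "j \<noteq> 3"
  shows "word_map sponge (column_word w) x $ j = word_map sponge w x $ j"
  using assms(1)
proof (induction w arbitrary: k)
  case (Cons i w)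
  then have IH: "word_map sponge (column_word w) x $ j = word_map sponge w x $ j"
    and i: "i \<in> tiles" by (auto simp: words_def)
  have "height (64 * (i div 64)) = height i" "64 * (i div 64) = 192 \<longleftrightarrow> i = 192"
    using i by (auto simp: height_def tiles_def)
  moreover have "j = 1 \<or> j = 2" using assms(2) exhaust_3 by blast
  ultimately have "ratio (64 * (i div 64)) $ j = ratio i $ j" "corner (64 * (i div 64)) $ j = corner i $ j"
    by auto
  then show ?case using IH by (simp add: column_word_def)
qed (simp add: column_word_def)

text \<open>The digits of a word in base 4, which locate its column among the \<open>4\<^sup>k\<close> columns of level \<open>k\<close>.\<close>

fun column_number :: "nat list \<Rightarrow> nat" where
  "column_number [] = 0"
| "column_number (i # w) = (i div 64) * 4 ^ length w + column_number w"

lemma word_map_sponge_column: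
  "word_map sponge w 0 $ 1 = real (column_number w) / 4 ^ length w"
  by (induction w) (auto simp: field_simps)

lemma column_number_less: "w \<in> words column_tiles k \<Longrightarrow> column_number w < 4 ^ k"
proof (induction k arbitrary: w)
  case (Suc k)
  then obtain i v where w: "w = i # v" "i \<in> column_tiles" "v \<in> words column_tiles k" by (auto simp: words_Suc)
  then have "column_number v < 4 ^ k" "length v = k" "i div 64 \<le> 3"
    using Suc.IH by (auto simp: words_def column_tiles_def)
  moreover have "(i div 64) * 4 ^ k \<le> 3 * 4 ^ k" by (rule mult_right_mono) (use calculation in auto)
  ultimately have "(i div 64) * 4 ^ length v + column_number v < 3 * 4 ^ k + 4 ^ k" by (metis add_le_less_mono)
  then show ?case using w by simp
qed (simp add: words_0)

lemma inj_column_number: "inj_on column_number (words column_tiles k)"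
proof (induction k)
  case (Suc k)
  show ?case
  proof (rule inj_onI)
    fix w w' assume ww: "w \<in> words column_tiles (Suc k)" "w' \<in> words column_tiles (Suc k)"
      "column_number w = column_number w'"
    then obtain i v i' v' where w: "w = i # v" "i \<in> column_tiles" "v \<in> words column_tiles k"
      "w' = i' # v'" "i' \<in> column_tiles" "v' \<in> words column_tiles k" by (auto simp: words_Suc)
    have l: "length v = k" "length v' = k" using w by (auto simp: words_def)
    have eq: "(i div 64) * 4 ^ k + column_number v = (i' div 64) * 4 ^ k + column_number v'"
      using ww(3) w l by simp
    have lt: "column_number v < 4 ^ k" "column_number v' < 4 ^ k"
      using column_number_less w by auto
    have "i div 64 = i' div 64" "column_number v = column_number v'"
      using arg_cong[OF eq, of "\<lambda>n. n div 4 ^ k"] arg_cong[OF eq, of "\<lambda>n. n mod 4 ^ k"] lt by auto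
    moreover then have "i = i'" using w by (auto simp: column_tiles_def)
    ultimately show "w = w'" using Suc w by (auto simp: inj_on_def)
  qed
qed (simp add: words_0)

section \<open>The projections of the sponge\<close>

lemma word_map_in_range:
  assumes "q \<in> cbox 0 (vec 1)"
  shows "word_map sponge w 0 $ j \<le> word_map sponge w q $ j"
    "word_map sponge w q $ j \<le> word_map sponge w 0 $ j + word_ratio w $ j"
proof -
  have "0 \<le> q $ j" "q $ j \<le> 1" using assms by (simp_all add: mem_box_cart)
  then have "0 \<le> word_ratio w $ j * q $ j" "word_ratio w $ j * q $ j \<le> word_ratio w $ j"
    using word_ratio_nonneg[of w j] by (auto intro: mult_left_le)
  then show "word_map sponge w 0 $ j \<le> word_map sponge w q $ j"
    "word_map sponge w q $ j \<le> word_map sponge w 0 $ j + word_ratio w $ j"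
    using word_map_sponge_nth[of w q j] by linarith+
qed

lemma four_powr_three_halves: "4 powr (3/2) = (8::real)"
proof -
    have "(4::real) powr (3/2) = (2 powr 2) powr (3/2)" by simp
    also have "\<dots> = 2 powr 3" unfolding powr_powr by simp
    finally show ?thesis by simp
qed

context
  fixes F :: "(real^3) set"
  assumes attractor: "is_attractor tiles sponge F" and in_cube: "F \<subseteq> cbox 0 (vec 1)"
begin

lemma coordinate_1_full: "{0..1} \<subseteq> (\<lambda>x. x $ 1) ` F"
proof (rule attractor_coordinate_full[OF attractor, where c = "15/16"
      and r = "\<lambda>i. ratio i $ 1" and t = "\<lambda>i. corner i $ 1"])
  fix y :: real assume y: "y \<in> {0..1}"
  define n where "n = (if y \<le> 1/4 then 0 else if y \<le> 1/2 then 1 else if y \<le> 3/4 then 2 else 3 :: nat)"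
  have "64 * n \<in> tiles" "4 * y - real n \<in> {0..1}" "y = ratio (64 * n) $ 1 * (4 * y - real n) + corner (64 * n) $ 1"
    using y by (auto simp: n_def tiles_def diff_divide_distrib)
  then show "\<exists>i\<in>tiles. \<exists>z\<in>{0..1}. y = ratio i $ 1 * z + corner i $ 1" by blast
qed (use ratio_bounds[of _ 1] in \<open>auto simp: less_imp_le\<close>)

lemma coordinate_2_full: "{0..1} \<subseteq> (\<lambda>x. x $ 2) ` F"
proof (rule attractor_coordinate_full[OF attractor, where c = "15/16"
      and r = "\<lambda>i. ratio i $ 2" and t = "\<lambda>i. corner i $ 2"])
  fix y :: real assume y: "y \<in> {0..1}"
  define i where "i = (if y \<le> 15/16 then 128 else 192 :: nat)"
  define z where "z = (if y \<le> 15/16 then y * 16/15 else (y - 1/16) * 16/15)"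
  have "i \<in> tiles" "z \<in> {0..1}" "y = ratio i $ 2 * z + corner i $ 2"
    using y by (auto simp: i_def z_def tiles_def height_def diff_divide_distrib)
  then show "\<exists>i\<in>tiles. \<exists>z\<in>{0..1}. y = ratio i $ 2 * z + corner i $ 2" by blast
qed (use ratio_bounds[of _ 2] in \<open>auto simp: less_imp_le\<close>)

lemma planar_projection_column_word:
  assumes "p \<in> F"
  shows "\<exists>v\<in>words column_tiles k. \<exists>q\<in>cbox 0 (vec 1). \<forall>j. j \<noteq> 3 \<longrightarrow> p $ j = word_map sponge v q $ j"
proof -
  obtain w q where w: "w \<in> words tiles k" "q \<in> F" "p = word_map sponge w q"
    using assms attractor_words[OF attractor, of k] by blast
  then have "\<forall>j. j \<noteq> 3 \<longrightarrow> p $ j = word_map sponge (column_word w) q $ j"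
    using column_word_planar by metis
  then show ?thesis using w(2) in_cube column_word_in[OF w(1)] by blast
qed

lemma bounded_planar_projection: "bounded (plane_proj 3 ` F)"
proof (rule bounded_subset[OF bounded_cbox[of 0 "vec 1"]])
  show "plane_proj 3 ` F \<subseteq> cbox 0 (vec 1)"
    using in_cube by (auto simp: plane_proj_def mem_box_cart subset_iff)
qed

text \<open>At scale \<open>4\<^sup>-\<^sup>k\<close> each of the \<open>4\<^sup>k\<close> columns is covered by a vertical stack of cubes; the stacks have total
height \<open>2\<^sup>k\<close>, and the rounding costs one cube for each column.\<close>

lemma upper_box_dim_plane: "upper_box_dim (plane_proj 3 ` F) \<le> ereal (3/2)"
proof (rule upper_box_dim_le[of _ 4 "3/2" 2])
  fix k :: nat
  define R where "R v = cbox (plane_proj 3 (word_map sponge v 0))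
      (plane_proj 3 (word_map sponge v 0) + vector [(1/4) ^ k, word_height v, 0])" for v
  have "plane_proj 3 ` F \<subseteq> (\<Union>v\<in>words column_tiles k. R v)"
  proof
    fix x assume "x \<in> plane_proj 3 ` F"
    then obtain p where p: "p \<in> F" "x = plane_proj 3 p" by blast
    obtain v q where v: "v \<in> words column_tiles k" "q \<in> cbox 0 (vec 1)"
      "\<And>j. j \<noteq> 3 \<Longrightarrow> p $ j = word_map sponge v q $ j" using planar_projection_column_word[OF p(1), of k] by blast
    have "length v = k" using v(1) by (simp add: words_def)
    then have "x \<in> R v"
      using word_map_in_range[OF v(2), of v 1] word_map_in_range[OF v(2), of v 2]
      by (simp add: R_def mem_box_cart forall_3 p(2) plane_proj_def v(3))
    then show "x \<in> (\<Union>v\<in>words column_tiles k. R v)" using v(1) by blast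
  qed
  then have "covering_number (1 / 4 ^ k) (plane_proj 3 ` F) \<le> covering_number (1 / 4 ^ k) (\<Union>v\<in>words column_tiles k. R v)"
    by (intro covering_number_mono bounded_UN) (auto simp: finite_words finite_column_tiles R_def)
  also have "\<dots> \<le> (\<Sum>v\<in>words column_tiles k. covering_number (1 / 4 ^ k) (R v))"
    by (intro covering_number_UN_le) (auto simp: finite_words finite_column_tiles R_def)
  finally have "real (covering_number (1 / 4 ^ k) (plane_proj 3 ` F))
      \<le> (\<Sum>v\<in>words column_tiles k. real (covering_number (1 / 4 ^ k) (R v)))" by (simp flip: of_nat_sum)
  also have "\<dots> \<le> (\<Sum>v\<in>words column_tiles k. word_height v * 4 ^ k + 1)"
  proof (rule sum_mono)
    fix v :: "nat list"
    have side: "\<forall>j. j \<noteq> 2 \<longrightarrow> vector [(1/4) ^ k, word_height v, 0 :: real] $ (j::3) \<le> 1 / 4 ^ k"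
      by (simp add: forall_3 power_one_over)
    have "real (covering_number (1 / 4 ^ k) (R v)) \<le>
        vector [(1/4) ^ k, word_height v, 0 :: real] $ (2::3) / (1 / 4 ^ k) + 1"
      unfolding R_def
      by (rule covering_number_cbox_le)
         (use side word_height_pos[of v] in \<open>auto simp: less_imp_le\<close>)
    then show "real (covering_number (1 / 4 ^ k) (R v)) \<le> word_height v * 4 ^ k + 1" by simp
  qed
  also have "\<dots> = (\<Sum>v\<in>words column_tiles k. word_height v) * 4 ^ k + real (card (words column_tiles k))"
    by (simp add: sum.distrib sum_distrib_right)
  also have "(\<Sum>v\<in>words column_tiles k. word_height v) = 2 ^ k"
    by (simp add: sum_words_prod_list sum_column_tiles_height)
  also have "card (words column_tiles k) = 4 ^ k"
    by (simp add: card_words[OF finite_column_tiles] card_column_tiles)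
  also have "2 ^ k * 4 ^ k + real (4 ^ k) = (8 ^ k + 4 ^ k :: real)"
    by (simp add: power_mult_distrib[symmetric])
  also have "\<dots> \<le> 2 * 8 ^ k" using power_mono[of "4::real" 8 k] by simp
  also have "(8::real) = 4 powr (3/2)" by (simp add: four_powr_three_halves)
  finally show "real (covering_number (1 / 4 ^ k) (plane_proj 3 ` F)) \<le> 2 * (4 powr (3/2)) ^ k" .
qed (auto simp: bounded_planar_projection)

text \<open>Every column word of length \<open>k\<close> contributes a piece of the projection that has full height in the
second coordinate, so the cubes that meet it have total height at least that of the word. As a cube of
side \<open>4\<^sup>-\<^sup>k\<close> meets at most three columns, the total number of cubes is at least \<open>2\<^sup>k 4\<^sup>k / 3\<close>.\<close>

lemma lower_box_dim_plane: "lower_box_dim (plane_proj 3 ` F) \<ge> ereal (3/2)"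
proof (rule lower_box_dim_ge[of _ 4 "3/2" "1/3"])
  fix k :: nat
  define h where "h = (1 / 4 ^ k :: real)"
  have h: "h > 0" by (simp add: h_def)
  obtain T where T: "finite T" "card T = covering_number h (plane_proj 3 ` F)"
    "plane_proj 3 ` F \<subseteq> (\<Union>a\<in>T. cbox a (a + vec h))"
    using optimal_cube_cover[OF bounded_planar_projection h] by blast
  let ?W = "words column_tiles k"
  have finW: "finite ?W" by (simp add: finite_words finite_column_tiles)
  \<comment> \<open>A cube with lower corner \<open>a\<close> can meet the column of \<open>v\<close> only if this holds.\<close>
  define meets where "meets a v \<longleftrightarrow> \<bar>real (column_number v) - a $ 1 / h\<bar> \<le> 1" for a :: "real^3" and v
  have few: "card {v\<in>?W. meets a v} \<le> 3" for a
  proof -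
    define z where "z = \<lfloor>a $ 1 / h\<rfloor>"
    have "int (column_number v) \<in> {z - 1..z + 1}" if "meets a v" for v
      using that unfolding meets_def z_def by (simp add: abs_le_iff) linarith
    then have "card (int ` column_number ` {v\<in>?W. meets a v}) \<le> card {z - 1..z + 1}"
      by (intro card_mono) auto
    moreover have "inj_on column_number {v\<in>?W. meets a v}"
      by (rule inj_on_subset[OF inj_column_number]) auto
    ultimately show ?thesis by (simp add: card_image inj_on_def)
  qed
  have tall: "word_height v \<le> real (card {a\<in>T. meets a v}) * h" if v: "v \<in> ?W" for v
  proof -
    let ?E = "plane_proj 3 ` word_map sponge v ` F"
    have len: "length v = k" using v by (simp add: words_def)
    have vt: "v \<in> words tiles k" using v column_tiles_subset by (auto simp: words_def)
    have sub: "word_map sponge v ` F \<subseteq> F" using attractor_words[OF attractor, of k] vt by blast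
    have "?E \<subseteq> (\<Union>a\<in>{a\<in>T. meets a v}. cbox a (a + vec h))"
    proof
      fix x assume "x \<in> ?E"
      then obtain q where q: "q \<in> F" "x = plane_proj 3 (word_map sponge v q)" by blast
      then have "x \<in> plane_proj 3 ` F" using sub by blast
      then obtain a where a: "a \<in> T" "x \<in> cbox a (a + vec h)" using T(3) by blast
      have qc: "q \<in> cbox 0 (vec 1)" using q(1) in_cube by blast
      have "real (column_number v) * h \<le> x $ 1" "x $ 1 \<le> real (column_number v) * h + h"
        using word_map_in_range[OF qc, of v 1]
        by (simp_all add: q(2) plane_proj_def word_map_sponge_column len h_def power_one_over)
      moreover have "a $ 1 \<le> x $ 1" "x $ 1 \<le> a $ 1 + h" using a(2) by (simp_all add: mem_box_cart)
      ultimately have "\<bar>real (column_number v) * h - a $ 1\<bar> \<le> h" by linarith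
      then have "meets a v" using h by (simp add: meets_def abs_le_iff field_simps)
      then show "x \<in> (\<Union>a\<in>{a\<in>T. meets a v}. cbox a (a + vec h))" using a by blast
    qed
    moreover have "{word_map sponge v 0 $ 2..word_map sponge v 0 $ 2 + word_height v} \<subseteq> (\<lambda>x. x $ 2) ` ?E"
    proof
      fix t assume t: "t \<in> {word_map sponge v 0 $ 2..word_map sponge v 0 $ 2 + word_height v}"
      define s where "s = (t - word_map sponge v 0 $ 2) / word_height v"
      have "s \<in> {0..1}" using t word_height_pos[of v] by (simp add: s_def divide_simps)
      then obtain q where q: "q \<in> F" "q $ 2 = s" using coordinate_2_full by (metis (mono_tags, lifting) imageE subsetD)
      have "t = plane_proj 3 (word_map sponge v q) $ 2"
        using word_height_pos[of v] q(2)
        by (simp add: plane_proj_def word_map_sponge_nth[of v q] s_def)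
      then show "t \<in> (\<lambda>x. x $ 2) ` ?E" using q(1) by blast
    qed
    ultimately show ?thesis
      using interval_length_le_card_cover[of "{a\<in>T. meets a v}" ?E h] T(1) h by fastforce
  qed
  have "2 ^ k = (\<Sum>v\<in>?W. word_height v)" by (simp add: sum_words_prod_list sum_column_tiles_height)
  also have "\<dots> \<le> (\<Sum>v\<in>?W. real (card {a\<in>T. meets a v}) * h)" by (intro sum_mono tall)
  also have "\<dots> = real (\<Sum>v\<in>?W. card {a\<in>T. meets a v}) * h" by (simp add: sum_distrib_right)
  also have "(\<Sum>v\<in>?W. card {a\<in>T. meets a v}) = (\<Sum>a\<in>T. card {v\<in>?W. meets a v})"
    unfolding card_eq_sum using finW T(1) by (rule sum.swap_restrict)
  also have "real \<dots> * h \<le> real (card T * 3) * h"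
    using few h by (intro mult_right_mono) (auto intro: sum_bounded_above[of T _ 3, simplified])
  finally have "2 ^ k * 4 ^ k \<le> real (card T) * 3" by (simp add: h_def field_simps)
  then show "1/3 * (4 powr (3/2)) ^ k \<le> real (covering_number (1 / 4 ^ k) (plane_proj 3 ` F))"
    using T(2) by (simp add: h_def four_powr_three_halves power_mult_distrib[symmetric])
qed (auto simp: bounded_planar_projection)

end

section \<open>The upper box dimension of the sponge\<close>

text \<open>The image under a word \<open>w\<close> of length \<open>k\<close> has thickness \<open>64\<^sup>-\<^sup>k\<close> and width \<open>4\<^sup>-\<^sup>k\<close>. Subdividing its
planar projection by column words \<open>v\<close> of length \<open>2k\<close> brings the width down to \<open>64\<^sup>-\<^sup>k\<close> as well, and leaves
pieces whose heights are the products of the heights of \<open>w\<close> and \<open>v\<close>. The sum of these products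
factorises.\<close>

lemma upper_box_dim_sponge:
  assumes attractor: "is_attractor tiles sponge F" and in_cube: "F \<subseteq> cbox 0 (vec 1)"
  shows "upper_box_dim F \<le> ereal 2"
proof (rule upper_box_dim_le[of _ 64 2 2])
  show "bounded F" using in_cube bounded_cbox bounded_subset by blast
  fix k :: nat
  let ?W = "words tiles k" and ?V = "words column_tiles (2 * k)"
  have fin: "finite ?W" "finite ?V" by (simp_all add: finite_words finite_tiles finite_column_tiles)
  define org where "org w v = (vector [word_map sponge w (word_map sponge v 0) $ 1,
      word_map sponge w (word_map sponge v 0) $ 2, word_map sponge w 0 $ 3] :: real^3)" for w v
  define s where "s w v = (vector [(1/64) ^ k, word_height w * word_height v, (1/64) ^ k] :: real^3)"
    for w v :: "nat list"
  define R where "R w v = cbox (org w v) (org w v + s w v)" for w v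
  have quarter: "(1/4) ^ k * (1/4) ^ (2 * k) = (1/64 :: real) ^ k"
    by (simp add: power_mult power_mult_distrib[symmetric] power2_eq_square)
  have "F \<subseteq> (\<Union>w\<in>?W. \<Union>v\<in>?V. R w v)"
  proof
    fix x assume "x \<in> F"
    then obtain w p where w: "w \<in> ?W" "p \<in> F" "x = word_map sponge w p"
      using attractor_words[OF attractor, of k] by blast
    obtain v q where v: "v \<in> ?V" "q \<in> cbox 0 (vec 1)"
      "\<And>j. j \<noteq> 3 \<Longrightarrow> p $ j = word_map sponge v q $ j"
      using planar_projection_column_word[OF attractor in_cube w(2), of "2 * k"] by blast
    have len: "length w = k" "length v = 2 * k" using w v by (auto simp: words_def)
    have inner: "word_map sponge w (word_map sponge v 0) $ j \<le> x $ j \<and>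
        x $ j \<le> word_map sponge w (word_map sponge v 0) $ j + word_ratio w $ j * word_ratio v $ j"
      if j: "j \<noteq> 3" and pos: "0 \<le> word_ratio w $ j" for j
    proof -
      have "word_map sponge v 0 $ j \<le> p $ j" "p $ j \<le> word_map sponge v 0 $ j + word_ratio v $ j"
        using word_map_in_range[OF v(2), of v j] v(3)[OF j] by auto
      then have "word_ratio w $ j * word_map sponge v 0 $ j \<le> word_ratio w $ j * p $ j"
        "word_ratio w $ j * p $ j \<le> word_ratio w $ j * (word_map sponge v 0 $ j + word_ratio v $ j)"
        using pos by (auto intro: mult_left_mono)
      then show ?thesis
        unfolding w(3) word_map_sponge_nth[of w p] word_map_sponge_nth[of w "word_map sponge v 0"]
        by (simp add: distrib_left)
    qed
    have "p \<in> cbox 0 (vec 1)" using w(2) in_cube by blast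
    then have "x \<in> R w v"
      using inner[of 1] inner[of 2] word_map_in_range[of p w 3] word_height_pos[of w]
      by (simp add: R_def org_def s_def mem_box_cart forall_3 w(3) len quarter less_imp_le)
    then show "x \<in> (\<Union>w\<in>?W. \<Union>v\<in>?V. R w v)" using w(1) v(1) by blast
  qed
  then have "F \<subseteq> (\<Union>(w, v)\<in>?W \<times> ?V. R w v)" by auto
  then have "covering_number (1 / 64 ^ k) F \<le> covering_number (1 / 64 ^ k) (\<Union>(w, v)\<in>?W \<times> ?V. R w v)"
    by (intro covering_number_mono bounded_UN) (auto simp: fin R_def)
  also have "\<dots> \<le> (\<Sum>(w, v)\<in>?W \<times> ?V. covering_number (1 / 64 ^ k) (R w v))"
    using covering_number_UN_le[of "?W \<times> ?V" "\<lambda>(w, v). R w v" "1 / 64 ^ k"]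
    by (auto simp: fin R_def split_beta)
  finally have "real (covering_number (1 / 64 ^ k) F)
      \<le> (\<Sum>(w, v)\<in>?W \<times> ?V. real (covering_number (1 / 64 ^ k) (R w v)))"
    by (simp add: split_beta flip: of_nat_sum)
  also have "\<dots> \<le> (\<Sum>(w, v)\<in>?W \<times> ?V. word_height w * word_height v * 64 ^ k + 1)"
  proof (rule sum_mono, clarify)
    fix w v :: "nat list"
    have side: "\<forall>j. j \<noteq> 2 \<longrightarrow> s w v $ j \<le> 1 / 64 ^ k"
      by (simp add: forall_3 power_one_over s_def)
    have "0 \<le> s w v $ 2" using word_height_pos[of v] word_height_pos[of w] by (simp add: s_def)
    then have "real (covering_number (1 / 64 ^ k) (R w v)) \<le> s w v $ 2 / (1 / 64 ^ k) + 1"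
      unfolding R_def by (rule covering_number_cbox_le[rotated]) (use side in auto)
    then show "real (covering_number (1 / 64 ^ k) (R w v)) \<le> word_height w * word_height v * 64 ^ k + 1"
      by (simp add: s_def)
  qed
  also have "\<dots> = (\<Sum>w\<in>?W. \<Sum>v\<in>?V. word_height w * word_height v * 64 ^ k + 1)"
    by (simp add: sum.cartesian_product)
  also have "\<dots> = (\<Sum>w\<in>?W. word_height w) * (\<Sum>v\<in>?V. word_height v) * 64 ^ k
      + real (card ?W) * real (card ?V)"
    by (simp add: sum.distrib sum_distrib_left[symmetric] sum_distrib_right[symmetric])
  also have "(\<Sum>w\<in>?W. word_height w) = (79/8) ^ k"
    unfolding sum_words_prod_list using sum_tiles_height[of "\<lambda>x. x"] by (intro arg_cong[of _ _ "\<lambda>x. x ^ k"]) linarith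
  also have "(\<Sum>v\<in>?V. word_height v) = 4 ^ k"
    by (simp add: sum_words_prod_list sum_column_tiles_height power_mult)
  also have "card ?W = 130 ^ k" by (simp add: card_words finite_tiles card_tiles)
  also have "card ?V = 16 ^ k" by (simp add: card_words[OF finite_column_tiles] card_column_tiles power_mult)
  also have "(79/8) ^ k * 4 ^ k * 64 ^ k + real (130 ^ k) * real (16 ^ k) = (2528 ^ k + 2080 ^ k :: real)"
    by (simp add: power_mult_distrib[symmetric])
  also have "\<dots> \<le> 2 * 4096 ^ k"
    using power_mono[of "2528::real" 4096 k] power_mono[of "2080::real" 4096 k] by simp
  finally show "real (covering_number (1 / 64 ^ k) F) \<le> 2 * (64 powr 2) ^ k" by simp
qed simp_all

section \<open>The pressure\<close>

lemma root_sandwich: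
  assumes L: "L > 0" and x: "\<And>k. k \<ge> 1 \<Longrightarrow> L ^ k \<le> x k \<and> x k \<le> C * L ^ k" and C: "C > 0"
  shows "(\<lambda>k. root k (x k)) \<longlonglongrightarrow> L"
proof (rule tendsto_sandwich[where f = "\<lambda>_. L" and h = "\<lambda>k. root k C * L"])
  have "(\<lambda>k. root k C * L) \<longlonglongrightarrow> 1 * L"
    using C by (intro tendsto_mult LIMSEQ_root_const tendsto_const)
  then show "(\<lambda>k. root k C * L) \<longlonglongrightarrow> L" by simp
  show "eventually (\<lambda>k. L \<le> root k (x k)) sequentially"
    using eventually_ge_at_top[of 1]
  proof eventually_elim
    case (elim k)
    then have "root k (L ^ k) \<le> root k (x k)" using x by (intro real_root_le_mono) auto
    then show ?case using elim L by (simp add: real_root_power_cancel)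
  qed
  show "eventually (\<lambda>k. root k (x k) \<le> root k C * L) sequentially"
    using eventually_ge_at_top[of 1]
  proof eventually_elim
    case (elim k)
    then have "root k (x k) \<le> root k (C * L ^ k)" using x by (intro real_root_le_mono) auto
    then show ?case using elim L by (simp add: real_root_power_cancel real_root_mult)
  qed
qed simp

lemma linear_part_word: "linear_part (word_map sponge w) = (\<chi> i j. if i = j then word_ratio w $ i else 0)"
  by (subst word_map_sponge) (rule linear_part_diag_affine)

lemma third_edge_shortest:
  assumes "length w = k" "k \<ge> 1"
  shows "(1/64) ^ k < (1/4 :: real) ^ k" "(1/64) ^ k < word_height w"
proof -
  show "(1/64) ^ k < (1/4 :: real) ^ k" using assms by (intro power_strict_mono) auto
  have "(1/64) ^ k < (1/16 :: real) ^ k" using assms by (intro power_strict_mono) auto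
  then show "(1/64) ^ k < word_height w" using word_height_ge[of w] assms by simp
qed

lemma word_sv_sponge:
  assumes "length w = k" "k \<ge> 1"
  shows "word_sv sponge 1 w = max ((1/4) ^ k) (word_height w)"
    "word_sv sponge 2 w = min ((1/4) ^ k) (word_height w)"
    "word_sv sponge 3 w = (1/64) ^ k"
proof -
  have "singular_values (linear_part (word_map sponge w)) =
      [max ((1/4) ^ k) (word_height w), min ((1/4) ^ k) (word_height w), (1/64) ^ k]"
    unfolding linear_part_word
    by (rule singular_values_diag) (use third_edge_shortest[OF assms] assms in \<open>auto simp: max_def min_def\<close>)
  then show "word_sv sponge 1 w = max ((1/4) ^ k) (word_height w)"
    "word_sv sponge 2 w = min ((1/4) ^ k) (word_height w)"
    "word_sv sponge 3 w = (1/64) ^ k" by (simp_all add: word_sv_def eval_nat_numeral)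
qed

text \<open>The arbitrary choices in the formula do not matter: the shortest direction is unique, and the first
and second axis projections have the same dimensions.\<close>

lemma direction_sponge:
  assumes "direction_choice tiles sponge a b" "w \<in> words tiles k" "k \<ge> 1"
  shows "a w \<noteq> 3" "b w = 3"
proof -
  have len: "length w = k" using assms(2) by (simp add: words_def)
  have edge: "edge_length sponge w j = word_ratio w $ j" for j
    using edge_length_diag_affine[OF word_map_sponge word_ratio_nonneg] .
  have dir: "word_ratio w $ j \<le> word_ratio w $ (a w)" "word_ratio w $ (b w) \<le> word_ratio w $ j" for j
    using assms(1)[unfolded direction_choice_def, rule_format, OF assms(3,2), of j] by (simp_all add: edge)
  show "a w \<noteq> 3" using dir(1)[of 1] third_edge_shortest(1)[OF len assms(3)] len by auto
  have "b w \<noteq> 1" "b w \<noteq> 2" using dir(2)[of 3] third_edge_shortest[OF len assms(3)] len by auto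
  then show "b w = 3" using exhaust_3[of "b w"] by blast
qed

text \<open>This turns the non-multiplicative quantity \<open>\<alpha>\<^sub>1 \<alpha>\<^sub>2\<^sup>1\<^sup>/\<^sup>2\<close> into a maximum of two expressions that are
multiplicative along words.\<close>

lemma max_mult_sqrt_min:
  fixes c d :: real
  assumes "0 \<le> c" "0 \<le> d"
  shows "max c d * sqrt (min c d) = max (c * sqrt d) (sqrt c * d)"
proof -
  have *: "c * sqrt d \<le> sqrt c * d" if "0 \<le> c" "c \<le> d" for c d :: real
  proof -
    have "sqrt c * (sqrt c * sqrt d) \<le> sqrt c * (sqrt d * sqrt d)"
      using that by (intro mult_left_mono mult_right_mono) auto
    then show ?thesis using that by (simp add: mult.assoc[symmetric])
  qed
  show ?thesis
  proof (cases "c \<le> d")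
    case True
    then show ?thesis using *[of c d] assms by (simp add: max_def min_def mult.commute)
  next
    case False
    then show ?thesis using *[of d c] assms by (simp add: max_def min_def mult.commute)
  qed
qed

text \<open>The sum over all tiles of \<open>\<surd>d / 4\<close>, where \<open>d\<close> is the height of the tile.\<close>

definition growth :: real where
  "growth = 8 + sqrt 15 / 8"

text \<open>The sum over words lies between the sum of the first weight and the sum of both weights. Since the
first one dominates, these bounds differ by a factor of at most 2, which the \<open>k\<close>-th root removes.\<close>

lemma pressure_sponge:
  assumes p: "\<And>w k. w \<in> words tiles k \<Longrightarrow> k \<ge> 1 \<Longrightarrow> p1 w = 1 \<and> p2 w = 3/2"
  shows "pressure tiles (psi sponge p1 p2) s = growth * 64 powr (3/2 - s)"
proof -
  define q where "q = 64 powr (3/2 - s)"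
  have q: "q > 0" by (simp add: q_def)
  have g: "growth > 0" by (simp add: growth_def add_pos_nonneg)
  define A where "A w = prod_list (map (\<lambda>i. sqrt (height i) / 4) w)" for w
  define B where "B w = prod_list (map (\<lambda>i. height i / 2) w)" for w
  have A: "A w = (1/4) ^ length w * sqrt (word_height w)" for w
    by (induction w) (auto simp: A_def real_sqrt_mult)
  have B: "B w = (1/2) ^ length w * word_height w" for w
    by (induction w) (auto simp: B_def)
  have psi: "psi sponge p1 p2 s w = max (A w) (B w) * q ^ k" if w: "w \<in> words tiles k" "k \<ge> 1" for w k
  proof -
    have len: "length w = k" using w by (simp add: words_def)
    let ?c = "(1/4 :: real) ^ k" and ?d = "word_height w"
    have pos: "?c > 0" "?d > 0" using word_height_pos by auto
    have sqc: "sqrt ?c = (1/2) ^ k"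
      by (simp add: real_sqrt_power real_sqrt_divide)
    have "max ?c ?d * sqrt (min ?c ?d) = max (?c * sqrt ?d) (sqrt ?c * ?d)"
      using pos by (intro max_mult_sqrt_min) auto
    also have "\<dots> = max (A w) (B w)" unfolding A B sqc len by simp
    finally have m: "max ?c ?d * sqrt (min ?c ?d) = max (A w) (B w)" .
    have "((1/64) ^ k) powr (s - 3/2) = q ^ k"
    proof -
      have "((1/64) ^ k) powr (s - 3/2) = ((1/64) powr (s - 3/2)) ^ k"
        by (simp add: powr_realpow[symmetric] powr_powr mult.commute)
      also have "(1/64) powr (s - 3/2) = q"
        by (simp add: q_def powr_divide powr_minus_divide[symmetric])
      finally show ?thesis .
    qed
    moreover have "p1 w = 1" "p2 w = 3/2" using p[OF w] by simp_all
    ultimately show ?thesis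
      using pos unfolding psi_def word_sv_sponge[OF len w(2)] m[symmetric] \<open>p1 w = 1\<close> \<open>p2 w = 3/2\<close>
      by (simp add: powr_half_sqrt less_max_iff_disj)
  qed
  have sumA: "(\<Sum>w\<in>words tiles k. A w) = growth ^ k" for k
  proof -
    have "(\<Sum>i\<in>tiles. sqrt (height i) / 4) = growth"
      using sum_tiles_height[of "\<lambda>x. sqrt x / 4"]
      by (simp add: growth_def real_sqrt_divide)
    then show ?thesis by (simp add: A_def sum_words_prod_list)
  qed
  have sumB: "(\<Sum>w\<in>words tiles k. B w) \<le> growth ^ k" for k
  proof -
    have "(\<Sum>i\<in>tiles. height i / 2) = 79/16"
      using sum_tiles_height[of "\<lambda>x. x / 2"] by simp
    then have "(\<Sum>w\<in>words tiles k. B w) = (79/16) ^ k"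
      unfolding B_def sum_words_prod_list by (rule arg_cong)
    also have "\<dots> \<le> growth ^ k" by (intro power_mono) (auto simp: growth_def intro: add_increasing2)
    finally show ?thesis .
  qed
  have "(\<lambda>k. root k (\<Sum>w\<in>words tiles k. psi sponge p1 p2 s w)) \<longlonglongrightarrow> growth * q"
  proof (rule root_sandwich[where C = 2])
    fix k :: nat assume k: "k \<ge> 1"
    have "(\<Sum>w\<in>words tiles k. psi sponge p1 p2 s w) = (\<Sum>w\<in>words tiles k. max (A w) (B w)) * q ^ k"
      using psi k by (simp add: sum_distrib_right)
    moreover have "growth ^ k \<le> (\<Sum>w\<in>words tiles k. max (A w) (B w))"
      unfolding sumA[symmetric] by (intro sum_mono) auto
    moreover have "(\<Sum>w\<in>words tiles k. max (A w) (B w)) \<le> (\<Sum>w\<in>words tiles k. A w + B w)"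
      by (intro sum_mono) (use word_height_pos in \<open>auto simp: A B less_imp_le\<close>)
    then have "(\<Sum>w\<in>words tiles k. max (A w) (B w)) \<le> 2 * growth ^ k"
      using sumA[of k] sumB[of k] by (simp add: sum.distrib)
    ultimately show "(growth * q) ^ k \<le> (\<Sum>w\<in>words tiles k. psi sponge p1 p2 s w) \<and>
        (\<Sum>w\<in>words tiles k. psi sponge p1 p2 s w) \<le> 2 * (growth * q) ^ k"
      using q by (simp add: power_mult_distrib)
  qed (use q g in auto)
  then show ?thesis unfolding pressure_def q_def by (rule limI)
qed

lemma zero_of_pressure:
  assumes "\<And>s. P s = growth * 64 powr (3/2 - s)"
  shows "(THE s. 0 \<le> s \<and> P s = 1) = 3/2 + log 64 growth"
proof (rule the_equality)
  have g: "growth \<ge> 1" by (simp add: growth_def add_increasing2)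
  have eq: "growth * 64 powr (3/2 - s) = 1 \<longleftrightarrow> s = 3/2 + log 64 growth" for s
  proof -
    have "growth * 64 powr (3/2 - s) = 64 powr (log 64 growth + (3/2 - s))"
      using g by (simp add: powr_add)
    then show ?thesis by auto
  qed
  show "0 \<le> 3/2 + log 64 growth \<and> P (3/2 + log 64 growth) = 1"
    unfolding assms using g eq[of "3/2 + log 64 growth"] by (simp only: zero_le_log_cancel_iff) simp
  show "s = 3/2 + log 64 growth" if "0 \<le> s \<and> P s = 1" for s
    using that eq[of s] unfolding assms by blast
qed

lemma two_less_zero: "2 < 3/2 + log 64 growth"
proof -
  have "64 powr (1/2) < growth" by (simp add: growth_def powr_half_sqrt)
  then have "1/2 < log 64 growth" by (subst less_log_iff) (auto simp: growth_def add_pos_nonneg)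
  then show ?thesis by simp
qed

section \<open>The strict inequality\<close>

theorem theorem5p5:
  "\<exists>(I :: nat set) (S :: nat \<Rightarrow> real^3 \<Rightarrow> real^3) (F :: (real^3) set).
     sponge_ifs I S \<and> is_attractor I S F \<and>
     (\<forall>i\<in>I. diagonal_matrix (linear_part (S i))) \<and> cosc I S \<and>
     (\<forall>a b. direction_choice I S a b \<longrightarrow>
        upper_box_dim F < ereal (lower_s0 I S F a b) \<and>
        lower_s0 I S F a b = upper_s0 I S F a b)"
proof -
  have cont: "continuous_on UNIV (sponge i)" for i
    unfolding sponge_def using ratio_bounds[of i]
    by (intro lipschitz_on_continuous_on[of "15/16"] lipschitz_diag_affine) (auto simp: abs_of_pos)
  have inj: "inj (sponge i)" for i
    unfolding sponge_def using ratio_bounds(1)[of i]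
    by (intro inj_diag_affine) (simp add: less_imp_neq[symmetric])
  have ne: "tiles \<noteq> {}" "cbox 0 (vec 1 :: real^3) \<noteq> {}"
    by (auto simp: tiles_def interval_ne_empty_cart)
  obtain F where F: "is_attractor tiles sponge F" "F \<subseteq> cbox 0 (vec 1)"
    by (rule attractor_exists[OF finite_tiles ne(1) compact_cbox ne(2) cont inj sponge_unit_cube(1)])
  have plane: "lower_box_dim (plane_proj 3 ` F) = ereal (3/2)" "upper_box_dim (plane_proj 3 ` F) = ereal (3/2)"
    using box_dims_eqI[OF lower_box_dim_plane[OF F] upper_box_dim_plane[OF F]] by auto
  have axis: "axis_proj j ` F = unit_segment j" if "j \<noteq> 3" for j
    using that exhaust_3[of j] axis_proj_eq_unit_segment[OF F(2)] coordinate_1_full[OF F] coordinate_2_full[OF F] by blast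
  have "upper_box_dim F < ereal (lower_s0 tiles sponge F a b) \<and>
      lower_s0 tiles sponge F a b = upper_s0 tiles sponge F a b"
    if dir: "direction_choice tiles sponge a b" for a b
  proof -
    have "pressure tiles (lower_psi sponge F a b) s = growth * 64 powr (3/2 - s)"
      "pressure tiles (upper_psi sponge F a b) s = growth * 64 powr (3/2 - s)" for s
      unfolding lower_psi_def upper_psi_def
      by (rule pressure_sponge; simp add: direction_sponge[OF dir] axis plane box_dim_unit_segment
            quasi_assouad_dim_unit_segment)+
    then have "lower_s0 tiles sponge F a b = 3/2 + log 64 growth"
      "upper_s0 tiles sponge F a b = 3/2 + log 64 growth"
      unfolding lower_s0_def upper_s0_def by (simp_all add: zero_of_pressure)
    moreover have "upper_box_dim F < ereal (3/2 + log 64 growth)"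
      using upper_box_dim_sponge[OF F] two_less_zero by (metis ereal_less(2) less_ereal.simps(1) order_le_less_trans)
    ultimately show ?thesis by simp
  qed
  then show ?thesis
    using sponge_ifs_sponge F(1) diagonal_sponge cosc_sponge by blast
qed

end
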